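(* Let $p\ge2$ (with $p<\infty$), let $X$ be a real Banach space with property $(\beta_p)$, and let $\omega_X\colon X\times X\to\mathbb R$ be a non-null, antisymmetric, bounded bilinear form. Then the Heisenberg group $(\mathbb H(\omega_X),d_{cc})$, equipped with the Carnot–Carathéodory metric, is infrasup-umbel $p$-convex.
   Context: **Property $(\beta_p)$.** A Banach space $X$ with closed unit ball $B_X$ has property $(\beta_p)$ (property $(\beta)$ with power type $p$) if there is a constant $c>0$ such that for every $t>0$, every $z\in B_X$ and every sequence $\{x_n\}_{n\in\mathbb N}\subseteq B_X$ with $\inf_{i\neq j}\|x_i-x_j\|\ge t$, there is $i_0\in\mathbb N$ with $\|\frac{z-x_{i_0}}2\|\le1-\bar\beta(t)$, for some function $\bar\beta$ satisfying $\bar\beta(t)\ge t^p/c$ for all $t>0$. **Heisenberg group.** $\mathbb H(\omega_X)$ is the set $X\times\mathbb R$ with the group law $(x,s)*(y,t)=(x+y,\,s+t+\omega_X(x,y))$. **Carnot–Carathéodory metric.** A pair $(\gamma,z)$ of Lipschitz curves $\gamma\colon[0,1]\to X$, $z\colon[0,1]\to\mathbb R$ is a horizontal curve if $\gamma$ is differentiable almost everywhere and $z'(t)=\omega_X(\gamma(t),\gamma'(t))$ for almost every $t\in[0,1]$; its horizontal length is the length of $\gamma$ in $X$. $d_{cc}(\mathbf x,\mathbf y)$ is the infimum of the horizontal lengths of horizontal curves joining $\mathbf x$ and $\mathbf y$. **Notation.** $\mathbb N=\{1,2,\dots\}$. $[\mathbb N]^{h}$ (resp. $[\mathbb N]^{\le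 h}$) is the set of subsets of $\mathbb N$ of size exactly $h$ (resp. at most $h$), whose elements are written as increasing tuples. $(\bar n,i,\bar m)$ denotes concatenation, and "$(\bar n,i,\bar m)\in[\mathbb N]^{\le h}$" means that the concatenated tuple is strictly increasing and of length at most $h$. $\mathsf T^\omega_h$ is the countably branching tree of height $h$: vertex set $[\mathbb N]^{\le h}$, edges between $(n_1,\dots,n_i)$ and $(n_1,\dots,n_i,n_{i+1})$, with the shortest path metric. **Infrasup-umbel $p$-convexity.** A metric space $(M,d)$ is infrasup-umbel $p$-convex if there is $C>0$ such that for all $k\ge1$ and all $f\colon\mathsf T^\omega_{2^k}\to M$, $$\sum_{s=1}^{k-1}\ \inf_{\bar n\in[\mathbb N]^{\le 2^k-2^s}}\ \inf_{i\ne j\in\mathbb N}\ \inf_{\substack{\bar m,\bar m'\in[\mathbb N]^{2^s-1}:\\(\bar n,i,\bar m),(\bar n,j,\bar m')\in[\mathbb N]^{\le2^k}}}\frac{d(f(\bar n,i,\bar m),f(\bar n,j,\bar m'))^p}{2^{sp}}\le C^p\,\mathrm{Lip}(f)^p,$$ where $\mathrm{Lip}(f)$ is the Lipschitz constant of $f$ and an infimum over the empty set is $+\infty$. *)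

theory Defs
  imports "HOL-Analysis.Analysis" "HOL-Algebra.Group"
begin

definition property_beta :: "'a::banach itself \<Rightarrow> real \<Rightarrow> bool" where
  "property_beta _ p \<longleftrightarrow>
     (\<exists>c>0. \<exists>\<beta> :: real \<Rightarrow> real.
        (\<forall>t>0. \<beta> t \<ge> t powr p / c) \<and>
        (\<forall>t>0. \<forall>z \<in> cball (0::'a) 1. \<forall>x :: nat \<Rightarrow> 'a.
           range x \<subseteq> cball 0 1 \<and> (INF (i, j) \<in> {(i, j). i \<noteq> j}. norm (x i - x j)) \<ge> t \<longrightarrow>
           (\<exists>i\<^sub>0. norm ((z - x i\<^sub>0) /\<^sub>R 2) \<le> 1 - \<beta> t)))"

definition heisenberg ::
  "('a::real_normed_vector \<Rightarrow> 'a \<Rightarrow> real) \<Rightarrow> ('a \<times> real) monoid" where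
  "heisenberg \<omega> =
     \<lparr>carrier = UNIV,
      monoid.mult = (\<lambda>(x, s) (y, t). (x + y, s + t + \<omega> x y)),
      one = (0, 0)\<rparr>"

lemma group_heisenberg:
  assumes "bounded_bilinear \<omega>" and "\<And>x y. \<omega> x y = - \<omega> y x"
  shows "group (heisenberg \<omega>)"
proof -
  interpret bounded_bilinear \<omega> by fact
  have alt: "\<omega> x x = 0" for x
    using assms(2)[of x x] by simp
  show ?thesis
  proof (rule groupI)
    fix u assume "u \<in> carrier (heisenberg \<omega>)"
    obtain x s where u: "u = (x, s)" by force
    show "\<exists>v \<in> carrier (heisenberg \<omega>). v \<otimes>\<^bsub>heisenberg \<omega>\<^esub> u = \<one>\<^bsub>heisenberg \<omega>\<^esub>"
      by (rule bexI[of _ "(- x, - s)"]) (simp_all add: heisenberg_def u alt minus_left)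
  qed (auto simp: heisenberg_def add_left add_right zero_left)
qed

text \<open>Derivatives at the endpoints of the unit interval are one-sided; this does not
  matter, since the conditions are only imposed almost everywhere.\<close>

definition horizontal_curve ::
  "('a::real_normed_vector \<Rightarrow> 'a \<Rightarrow> real) \<Rightarrow> (real \<Rightarrow> 'a) \<Rightarrow> (real \<Rightarrow> real) \<Rightarrow> bool" where
  "horizontal_curve \<omega> \<gamma> z \<longleftrightarrow>
     (\<exists>L. L-lipschitz_on {0..1} \<gamma>) \<and>
     (\<exists>L. L-lipschitz_on {0..1} z) \<and>
     (AE t in lebesgue_on {0..1}. \<gamma> differentiable (at t within {0..1})) \<and>
     (AE t in lebesgue_on {0..1}.
        (z has_real_derivative \<omega> (\<gamma> t) (vector_derivative \<gamma> (at t within {0..1})))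
          (at t within {0..1}))"

text \<open>The metric length, i.e. the supremum over all partitions, a partition being
  given by the sorted list of its points.\<close>

definition curve_length :: "(real \<Rightarrow> 'a::metric_space) \<Rightarrow> ennreal" where
  "curve_length \<gamma> =
     (SUP ts \<in> {ts. sorted ts \<and> set ts \<subseteq> {0..1}}.
        \<Sum>i<length ts - 1. ennreal (dist (\<gamma> (ts ! i)) (\<gamma> (ts ! Suc i))))"

definition cc_dist ::
  "('a::real_normed_vector \<Rightarrow> 'a \<Rightarrow> real) \<Rightarrow> 'a \<times> real \<Rightarrow> 'a \<times> real \<Rightarrow> real" where
  "cc_dist \<omega> u v =
     enn2real (INF (\<gamma>, z) \<in> {(\<gamma>, z). horizontal_curve \<omega> \<gamma> z \<and>
                                   (\<gamma> 0, z 0) = u \<and> (\<gamma> 1, z 1) = v}.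
                 curve_length \<gamma>)"

text \<open>Finite subsets of the positive integers are represented by the strictly
  increasing lists of their elements.\<close>

definition tuples :: "nat \<Rightarrow> nat list set" where
  "tuples h = {ns. sorted_wrt (<) ns \<and> set ns \<subseteq> {1..} \<and> length ns = h}"

definition tuples_le :: "nat \<Rightarrow> nat list set" where
  "tuples_le h = {ns. sorted_wrt (<) ns \<and> set ns \<subseteq> {1..} \<and> length ns \<le> h}"

definition tree_edge :: "nat \<Rightarrow> nat list \<Rightarrow> nat list \<Rightarrow> bool" where
  "tree_edge h u v \<longleftrightarrow>
     u \<in> tuples_le h \<and> v \<in> tuples_le h \<and> (\<exists>n. v = u @ [n] \<or> u = v @ [n])"

text \<open>The least length of a walk from \<open>u\<close> to \<open>v\<close>; the tree is connected,
  so such a walk exists for all vertices.\<close>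

definition tree_dist :: "nat \<Rightarrow> nat list \<Rightarrow> nat list \<Rightarrow> nat" where
  "tree_dist h u v = (LEAST n. (tree_edge h ^^ n) u v)"

text \<open>Lipschitz constant of a map defined on the tree of height \<open>h\<close>; it is \<open>\<infinity>\<close>
  if the map is not Lipschitz.\<close>

definition tree_lip :: "('m \<Rightarrow> 'm \<Rightarrow> real) \<Rightarrow> nat \<Rightarrow> (nat list \<Rightarrow> 'm) \<Rightarrow> ennreal" where
  "tree_lip d h f =
     (SUP (u, v) \<in> {(u, v). u \<in> tuples_le h \<and> v \<in> tuples_le h \<and> u \<noteq> v}.
        ennreal (d (f u) (f v) / real (tree_dist h u v)))"

text \<open>Only meant for exponents \<open>p > 0\<close>.\<close>

definition ennreal_powr :: "ennreal \<Rightarrow> real \<Rightarrow> ennreal" where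
  "ennreal_powr x p = (if x = \<infinity> then \<infinity> else ennreal (enn2real x powr p))"

text \<open>The infima are taken in \<^typ>\<open>ennreal\<close>, where the infimum of the empty set is \<open>\<infinity>\<close>;
  the innermost one is over the empty set unless \<open>i\<close> and \<open>j\<close> both exceed all entries
  of \<open>ns\<close>.\<close>

definition infrasup_umbel_convex :: "real \<Rightarrow> 'm set \<Rightarrow> ('m \<Rightarrow> 'm \<Rightarrow> real) \<Rightarrow> bool" where
  "infrasup_umbel_convex p M d \<longleftrightarrow>
     Metric_space M d \<and>
     (\<exists>C::real. C > 0 \<and>
        (\<forall>k::nat. k \<ge> 1 \<longrightarrow> (\<forall>f \<in> tuples_le (2 ^ k) \<rightarrow> M.
           (\<Sum>s = 1..k - 1.
              INF ns \<in> tuples_le (2 ^ k - 2 ^ s).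
              INF (i, j) \<in> {(i, j). i \<ge> 1 \<and> j \<ge> 1 \<and> i \<noteq> j}.
              INF (ms, ms') \<in> {(ms, ms'). ms \<in> tuples (2 ^ s - 1) \<and> ms' \<in> tuples (2 ^ s - 1) \<and>
                                 ns @ i # ms \<in> tuples_le (2 ^ k) \<and>
                                 ns @ j # ms' \<in> tuples_le (2 ^ k)}.
                ennreal (d (f (ns @ i # ms)) (f (ns @ j # ms')) powr p / 2 powr (real s * p)))
           \<le> ennreal (C powr p) * ennreal_powr (tree_lip d (2 ^ k) f) p)))"

end

theory Submission
  imports Defs "HOL-Library.Ramsey"
begin

text \<open>
  Only the projection \<open>X \<times> \<real> \<rightarrow> X\<close> of a map \<open>f\<close> on the tree matters. If \<open>x n\<close> is a
  \<open>d\<^sub>c\<^sub>c\<close>-bounded sequence with \<open>d\<^sub>c\<^sub>c (x m) (x n) \<ge> \<delta>\<close> for \<open>m \<noteq> n\<close>, then along a subsequence the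
  vertical components of \<open>(x m)\<inverse> * x n\<close> are arbitrarily small: they are bounded, and
  property \<open>(\<beta>)\<close> excludes a bounded sequence \<open>b\<close> in \<open>X\<close> with \<open>\<omega> (b i) (b j) \<ge> \<epsilon>\<close> for all
  \<open>i < j\<close>, so that Ramsey's theorem applies. Since \<open>d\<^sub>c\<^sub>c\<close> is at most the horizontal distance plus
  a multiple of the square root of the vertical one, the projections to \<open>X\<close> remain
  \<open>\<delta>/2\<close>-separated.

  Let \<open>B s\<close> be a number such that below every vertex, in every prescribed first direction, there
  is a descendant at distance \<open>2^s\<close> whose horizontal displacement, divided by \<open>2^s\<close>, has \<open>p\<close>-th
  power at most \<open>B s\<close>. Going down by \<open>2^s\<close> twice, with infinitely many choices for the second
  half, property \<open>(\<beta>\<^sub>p)\<close> allows \<open>B (s + 1) = B s - \<Delta> s / K\<close>, where \<open>\<Delta> s\<close> is the \<open>s\<close>-th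
  term of the umbel sum. Telescoping from \<open>B 0 = Lip(f)^p\<close> to \<open>B k \<ge> 0\<close> bounds the sum.
\<close>

section \<open>Length of curves\<close>

text \<open>A control function plays the role of arc length; unlike the latter it is easily
  transported along concatenation and reversal of curves.\<close>

definition length_control :: "(real \<Rightarrow> 'a::metric_space) \<Rightarrow> (real \<Rightarrow> real) \<Rightarrow> bool" where
  "length_control \<gamma> l \<longleftrightarrow>
     (\<forall>s t. 0 \<le> s \<longrightarrow> s \<le> t \<longrightarrow> t \<le> 1 \<longrightarrow> dist (\<gamma> s) (\<gamma> t) \<le> l t - l s)"

lemma length_controlD:
  "length_control \<gamma> l \<Longrightarrow> 0 \<le> s \<Longrightarrow> s \<le> t \<Longrightarrow> t \<le> 1 \<Longrightarrow> dist (\<gamma> s) (\<gamma> t) \<le> l t - l s"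
  by (simp add: length_control_def)

lemma length_control_mono:
  assumes "length_control \<gamma> l" "0 \<le> s" "s \<le> t" "t \<le> 1"
  shows "l s \<le> l t"
  using length_controlD[OF assms] zero_le_dist[of "\<gamma> s" "\<gamma> t"] by linarith

lemma curve_length_le_control:
  assumes "length_control \<gamma> l"
  shows "curve_length \<gamma> \<le> ennreal (l 1 - l 0)"
  unfolding curve_length_def
proof (rule SUP_least, clarify)
  fix ts :: "real list"
  assume ts: "sorted ts" "set ts \<subseteq> {0..1}"
  show "(\<Sum>i<length ts - 1. ennreal (dist (\<gamma> (ts ! i)) (\<gamma> (ts ! Suc i)))) \<le> ennreal (l 1 - l 0)"
  proof (cases "ts = []")
    case False
    have r: "0 \<le> ts ! i" "ts ! i \<le> 1" if "i < length ts" for i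
      using ts nth_mem[OF that] by auto
    have "(\<Sum>i<length ts - 1. dist (\<gamma> (ts ! i)) (\<gamma> (ts ! Suc i)))
        \<le> (\<Sum>i<length ts - 1. l (ts ! Suc i) - l (ts ! i))"
      by (intro sum_mono length_controlD[OF assms] r sorted_nth_mono[OF ts(1)]) auto
    also have "\<dots> = l (ts ! (length ts - 1)) - l (ts ! 0)"
      by (rule sum_lessThan_telescope)
    also have "\<dots> \<le> l 1 - l 0"
      using False by (intro diff_mono length_control_mono[OF assms] r) auto
    finally show ?thesis
      by (subst sum_ennreal) (auto intro: ennreal_leI)
  qed auto
qed

text \<open>The control is arc length: \<open>V t\<close> is the supremum over the partitions of
  [0,t]. Its superadditivity is the control inequality, and finiteness of the total length allows
  the passage from \<open>ennreal\<close> to real differences.\<close>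

lemma exists_length_control:
  assumes fin: "curve_length \<gamma> < \<infinity>"
  obtains l where "length_control \<gamma> l" "l 1 - l 0 \<le> enn2real (curve_length \<gamma>)"
proof
  let ?P = "\<lambda>t. {ts. sorted ts \<and> set ts \<subseteq> {0..t}} :: real list set"
  let ?S = "\<lambda>ts. \<Sum>i<length ts - 1. ennreal (dist (\<gamma> (ts ! i)) (\<gamma> (ts ! Suc i)))"
  define V where "V t = (SUP ts \<in> ?P t. ?S ts)" for t
  have V1: "V 1 = curve_length \<gamma>"
    by (simp add: V_def curve_length_def)
  have V: "V t < \<infinity>" if "t \<le> 1" for t
  proof -
    have "V t \<le> V 1"
      unfolding V_def using that by (intro SUP_subset_mono) auto
    then show ?thesis using fin V1 by (simp add: le_less_trans)
  qed
  show "length_control \<gamma> (\<lambda>t. enn2real (V t))"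
    unfolding length_control_def
  proof (intro allI impI)
    fix s t :: real assume st: "0 \<le> s" "s \<le> t" "t \<le> 1"
    let ?d = "ennreal (dist (\<gamma> s) (\<gamma> t))"
    have "V s + ?d = (SUP ts \<in> ?P s. ?S ts + ?d)"
      unfolding V_def by (rule ennreal_SUP_add_left[symmetric]) (auto intro: exI[of _ "[]"])
    also have "\<dots> \<le> V t"
    proof (rule SUP_least, clarify)
      fix ts assume ts: "sorted ts" "set ts \<subseteq> {0..s}"
      \<comment> \<open>With \<open>s\<close> inserted before \<open>t\<close>, the last summand is
        exactly \<open>?d\<close>. The summand leading to \<open>s\<close> is discarded, which also
        covers the empty partition.\<close>
      let ?us = "ts @ [s, t]"
      have us: "?us \<in> ?P t"
        using ts st by (auto simp: sorted_append)
      have "?S ts = (\<Sum>i<length ts - 1. ennreal (dist (\<gamma> (?us ! i)) (\<gamma> (?us ! Suc i))))"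
        by (rule sum.cong) (auto simp: nth_append)
      also have "\<dots> \<le> (\<Sum>i<length ts. ennreal (dist (\<gamma> (?us ! i)) (\<gamma> (?us ! Suc i))))"
        by (rule sum_mono2) auto
      finally have "?S ts + ?d \<le> ?S ?us"
        by (simp add: nth_append add_right_mono)
      also have "\<dots> \<le> V t"
        unfolding V_def by (rule SUP_upper[OF us])
      finally show "?S ts + ?d \<le> V t" .
    qed
    finally have "enn2real (V s + ?d) \<le> enn2real (V t)"
      using V[of t] st by (intro enn2real_mono) auto
    then show "dist (\<gamma> s) (\<gamma> t) \<le> enn2real (V t) - enn2real (V s)"
      using V[of s] st by (simp add: enn2real_plus)
  qed
  show "enn2real (V 1) - enn2real (V 0) \<le> enn2real (curve_length \<gamma>)"
    by (simp add: V1)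
qed

section \<open>Almost everywhere conditions and affine reparametrisation\<close>

lemma negligible_affine_image:
  fixes N :: "real set"
  assumes "negligible N"
  shows "negligible ((\<lambda>x. a * x + b) ` N)"
  by (rule negligible_differentiable_image_negligible)
    (auto intro!: assms derivative_intros simp: differentiable_on_def)

lemma AE_lebesgue_on_iff_negligible:
  assumes "S \<in> sets lebesgue"
  shows "(AE t in lebesgue_on S. P t) \<longleftrightarrow> (\<exists>N. negligible N \<and> (\<forall>t \<in> S - N. P t))"
proof -
  have "(AE t in lebesgue_on S. P t) \<longleftrightarrow> (AE t in lebesgue. t \<in> S \<longrightarrow> P t)"
    using assms by (intro AE_restrict_space_iff) auto
  also have "\<dots> \<longleftrightarrow> (\<exists>N \<in> null_sets lebesgue. {t. \<not> (t \<in> S \<longrightarrow> P t)} \<subseteq> N)"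
    by (simp add: eventually_ae_filter)
  also have "\<dots> \<longleftrightarrow> (\<exists>N. negligible N \<and> (\<forall>t \<in> S - N. P t))"
    unfolding negligible_iff_null_sets by blast
  finally show ?thesis .
qed

text \<open>Adding the endpoints 0 and 1 to the exceptional set makes the one-sided derivatives
  two-sided, and a witness \<open>g'\<close> replaces \<open>vector_derivative\<close>. In this form
  the condition is easily transported along reparametrisations.\<close>

lemma horizontal_curve_iff:
  "horizontal_curve \<omega> \<gamma> z \<longleftrightarrow>
     (\<exists>L. L-lipschitz_on {0..1} \<gamma>) \<and> (\<exists>L. L-lipschitz_on {0..1} z) \<and>
     (\<exists>N. negligible N \<and> (\<forall>t \<in> {0..1} - N. \<exists>g'.
        (\<gamma> has_vector_derivative g') (at t) \<and> (z has_real_derivative \<omega> (\<gamma> t) g') (at t)))"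
  (is "_ \<longleftrightarrow> _ \<and> _ \<and> (\<exists>N. negligible N \<and> (\<forall>t \<in> {0..1} - N. ?D t))")
proof -
  let ?P = "\<lambda>t. \<gamma> differentiable (at t within {0..1}) \<and>
      (z has_real_derivative \<omega> (\<gamma> t) (vector_derivative \<gamma> (at t within {0..1}))) (at t within {0..1})"
  have within: "at t within {0..1} = at t" if "t \<in> {0..1} - {0, 1}" for t :: real
    using that by (intro at_within_interior) auto
  have PD: "?P t \<longleftrightarrow> ?D t" if "t \<in> {0..1} - {0, 1}" for t
    unfolding within[OF that]
    by (auto simp: vector_derivative_works vector_derivative_at differentiableI_vector
        simp del: has_real_derivative_iff_has_vector_derivative)
  have "(AE t in lebesgue_on {0..1}. ?P t) \<longleftrightarrow> (\<exists>N. negligible N \<and> (\<forall>t \<in> {0..1} - N. ?P t))"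
    by (rule AE_lebesgue_on_iff_negligible) auto
  also have "\<dots> \<longleftrightarrow> (\<exists>N. negligible N \<and> (\<forall>t \<in> {0..1} - N. ?D t))"
  proof (intro iffI; elim exE conjE)
    fix N assume "negligible N" "\<forall>t \<in> {0..1} - N. ?P t"
    then have "negligible (N \<union> {0, 1})" "\<forall>t \<in> {0..1} - (N \<union> {0, 1}). ?D t"
      using PD by (simp, blast)
    then show "\<exists>N. negligible N \<and> (\<forall>t \<in> {0..1} - N. ?D t)"
      by blast
  next
    fix N assume "negligible N" "\<forall>t \<in> {0..1} - N. ?D t"
    then have "negligible (N \<union> {0, 1})" "\<forall>t \<in> {0..1} - (N \<union> {0, 1}). ?P t"
      using PD by (simp, blast)
    then show "\<exists>N. negligible N \<and> (\<forall>t \<in> {0..1} - N. ?P t)"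
      by blast
  qed
  finally show ?thesis
    unfolding horizontal_curve_def by (simp add: eventually_conj_iff)
qed

lemma lipschitz_on_affine_comp:
  fixes f :: "real \<Rightarrow> 'a::metric_space"
  assumes "L-lipschitz_on S f" "\<And>t. t \<in> T \<Longrightarrow> a * t + b \<in> S"
  shows "(L * \<bar>a\<bar>)-lipschitz_on T (\<lambda>t. f (a * t + b))"
proof (rule lipschitz_onI)
  fix s t assume st: "s \<in> T" "t \<in> T"
  have "dist (f (a * s + b)) (f (a * t + b)) \<le> L * dist (a * s + b) (a * t + b)"
    using assms st by (intro lipschitz_onD[OF assms(1)]) auto
  also have "dist (a * s + b) (a * t + b) = \<bar>a\<bar> * dist s t"
    by (simp add: dist_real_def flip: abs_mult right_diff_distrib)
  finally show "dist (f (a * s + b)) (f (a * t + b)) \<le> L * \<bar>a\<bar> * dist s t"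
    by (simp add: mult.assoc)
next
  show "0 \<le> L * \<bar>a\<bar>"
    using lipschitz_on_nonneg[OF assms(1)] by simp
qed

lemma has_vector_derivative_affine_comp:
  assumes "(f has_vector_derivative f') (at (a * t + b))"
  shows "((\<lambda>t. f (a * t + b)) has_vector_derivative a *\<^sub>R f') (at t)"
proof -
  have "((\<lambda>t. a * t + b) has_vector_derivative a) (at t)"
    by (auto intro!: derivative_eq_intros
        simp flip: has_real_derivative_iff_has_vector_derivative)
  from vector_diff_chain_at[OF this assms] show ?thesis
    by (simp add: o_def)
qed

section \<open>The Carnot--Caratheodory metric\<close>

locale nonnull_alternating_form =
  bounded_bilinear \<omega> for \<omega> :: "'a::banach \<Rightarrow> 'a \<Rightarrow> real" +
  assumes antisym: "\<omega> x y = - \<omega> y x"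
    and nonnull: "\<exists>x y. \<omega> x y \<noteq> 0"
begin

lemma alt [simp]: "\<omega> x x = 0"
  using antisym[of x x] by simp

text \<open>A real bound on a control stands in for the \<open>ennreal\<close> length. The predicate
  follows from \<open>cc_dist \<omega> u v < L\<close> and implies
  \<open>cc_dist \<omega> u v \<le> L\<close>, so the metric axioms can be proved on curves.\<close>

definition joined :: "real \<Rightarrow> 'a \<times> real \<Rightarrow> 'a \<times> real \<Rightarrow> bool" where
  "joined L u v \<longleftrightarrow>
     (\<exists>\<gamma> z l. horizontal_curve \<omega> \<gamma> z \<and> (\<gamma> 0, z 0) = u \<and> (\<gamma> 1, z 1) = v \<and>
        length_control \<gamma> l \<and> l 1 - l 0 \<le> L)"

text \<open>The vertical component of \<open>u\<inverse> * v\<close> in the Heisenberg group.\<close>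

definition vert :: "'a \<times> real \<Rightarrow> 'a \<times> real \<Rightarrow> real" where
  "vert u v = snd v - snd u - \<omega> (fst u) (fst v)"

text \<open>Both derivatives are multiplied by \<open>a\<close>, and \<open>\<omega>\<close> is
  linear in its second argument, so horizontality survives affine changes of time. Reversal uses
  \<open>a = -1\<close>, concatenation \<open>a = 2\<close>.\<close>

lemma horizontal_derivative_affine_comp:
  assumes "(\<gamma> has_vector_derivative g') (at (a * t + b))"
    and "(z has_real_derivative \<omega> (\<gamma> (a * t + b)) g') (at (a * t + b))"
  shows "\<exists>g'. ((\<lambda>t. \<gamma> (a * t + b)) has_vector_derivative g') (at t) \<and>
    ((\<lambda>t. z (a * t + b)) has_real_derivative \<omega> (\<gamma> (a * t + b)) g') (at t)"
proof (intro exI[of _ "a *\<^sub>R g'"] conjI)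
  show "((\<lambda>t. \<gamma> (a * t + b)) has_vector_derivative a *\<^sub>R g') (at t)"
    by (rule has_vector_derivative_affine_comp[OF assms(1)])
  show "((\<lambda>t. z (a * t + b)) has_real_derivative \<omega> (\<gamma> (a * t + b)) (a *\<^sub>R g')) (at t)"
    using has_vector_derivative_affine_comp[OF assms(2)[unfolded has_real_derivative_iff_has_vector_derivative]]
    by (simp add: has_real_derivative_iff_has_vector_derivative scaleR_right)
qed

lemma joined_sym:
  assumes "joined L u v"
  shows "joined L v u"
proof -
  from assms obtain \<gamma> z l where h: "horizontal_curve \<omega> \<gamma> z"
    and e: "(\<gamma> 0, z 0) = u" "(\<gamma> 1, z 1) = v" and l: "length_control \<gamma> l" "l 1 - l 0 \<le> L"
    unfolding joined_def by blast
  from h obtain N L1 L2 where N: "negligible N"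
    "\<And>t. t \<in> {0..1} - N \<Longrightarrow> \<exists>g'. (\<gamma> has_vector_derivative g') (at t) \<and>
        (z has_real_derivative \<omega> (\<gamma> t) g') (at t)"
    and L: "L1-lipschitz_on {0..1} \<gamma>" "L2-lipschitz_on {0..1} z"
    unfolding horizontal_curve_iff by blast
  \<comment> \<open>Time reversal is spelled \<open>(-1) * x + 1\<close> to match the affine
    composition lemmas literally. It is its own inverse, so \<open>N'\<close> is also the preimage
    of \<open>N\<close>.\<close>
  define N' where "N' = (\<lambda>x. (-1) * x + 1) ` N"
  have D: "\<exists>g'. ((\<lambda>t. \<gamma> ((-1) * t + 1)) has_vector_derivative g') (at t) \<and>
      ((\<lambda>t. z ((-1) * t + 1)) has_real_derivative \<omega> (\<gamma> ((-1) * t + 1)) g') (at t)"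
    if "t \<in> {0..1} - N'" for t
  proof -
    have "(-1) * t + 1 \<notin> N"
    proof
      assume "(-1) * t + 1 \<in> N"
      then have "(-1) * ((-1) * t + 1) + 1 \<in> N'"
        unfolding N'_def by (rule imageI)
      with that show False by simp
    qed
    with that have "(-1) * t + 1 \<in> {0..1} - N"
      by simp
    then show ?thesis
      using N(2) horizontal_derivative_affine_comp by blast
  qed
  have "negligible N'"
    unfolding N'_def by (rule negligible_affine_image[OF N(1)])
  then have "horizontal_curve \<omega> (\<lambda>t. \<gamma> ((-1) * t + 1)) (\<lambda>t. z ((-1) * t + 1))"
    unfolding horizontal_curve_iff using D
    by (intro conjI exI[of _ N'] exI[of _ "L1 * \<bar>-1\<bar>"] exI[of _ "L2 * \<bar>-1\<bar>"]
        lipschitz_on_affine_comp[OF L(1)] lipschitz_on_affine_comp[OF L(2)]) auto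
  moreover have "length_control (\<lambda>t. \<gamma> ((-1) * t + 1)) (\<lambda>t. - l ((-1) * t + 1))"
    unfolding length_control_def
  proof (intro allI impI)
    fix s t :: real assume "0 \<le> s" "s \<le> t" "t \<le> 1"
    then show "dist (\<gamma> ((-1) * s + 1)) (\<gamma> ((-1) * t + 1)) \<le> - l ((-1) * t + 1) - - l ((-1) * s + 1)"
      using length_controlD[OF l(1), of "(-1) * t + 1" "(-1) * s + 1"]
      by (simp add: dist_commute)
  qed
  ultimately show ?thesis
    unfolding joined_def using e l(2)
    by (intro exI[of _ "\<lambda>t. \<gamma> ((-1) * t + 1)"] exI[of _ "\<lambda>t. z ((-1) * t + 1)"]
        exI[of _ "\<lambda>t. - l ((-1) * t + 1)"]) auto
qed

lemma joined_trans:
  assumes "joined L u v" "joined L' v w"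
  shows "joined (L + L') u w"
proof -
  from assms(1) obtain \<gamma>1 z1 l1 where h1: "horizontal_curve \<omega> \<gamma>1 z1"
    and e1: "(\<gamma>1 0, z1 0) = u" "(\<gamma>1 1, z1 1) = v"
    and l1: "length_control \<gamma>1 l1" "l1 1 - l1 0 \<le> L"
    unfolding joined_def by blast
  from assms(2) obtain \<gamma>2 z2 l2 where h2: "horizontal_curve \<omega> \<gamma>2 z2"
    and e2: "(\<gamma>2 0, z2 0) = v" "(\<gamma>2 1, z2 1) = w"
    and l2: "length_control \<gamma>2 l2" "l2 1 - l2 0 \<le> L'"
    unfolding joined_def by blast
  from h1 obtain N1 A1 B1 where N1: "negligible N1"
    "\<And>t. t \<in> {0..1} - N1 \<Longrightarrow> \<exists>g'. (\<gamma>1 has_vector_derivative g') (at t) \<and>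
        (z1 has_real_derivative \<omega> (\<gamma>1 t) g') (at t)"
    and L1: "A1-lipschitz_on {0..1} \<gamma>1" "B1-lipschitz_on {0..1} z1"
    unfolding horizontal_curve_iff by blast
  from h2 obtain N2 A2 B2 where N2: "negligible N2"
    "\<And>t. t \<in> {0..1} - N2 \<Longrightarrow> \<exists>g'. (\<gamma>2 has_vector_derivative g') (at t) \<and>
        (z2 has_real_derivative \<omega> (\<gamma>2 t) g') (at t)"
    and L2: "A2-lipschitz_on {0..1} \<gamma>2" "B2-lipschitz_on {0..1} z2"
    unfolding horizontal_curve_iff by blast
  \<comment> \<open>The exceptional sets are carried to the two halves of [0,1]. The junction 1/2,
    where the derivatives of the two pieces may differ, is added.\<close>
  define N where "N = (\<lambda>x. (1/2) * x + 0) ` N1 \<union> (\<lambda>x. (1/2) * x + 1/2) ` N2 \<union> {1/2}"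
  define \<gamma> where "\<gamma> t = (if t \<le> 1/2 then \<gamma>1 (2 * t + 0) else \<gamma>2 (2 * t + -1))" for t
  define z where "z t = (if t \<le> 1/2 then z1 (2 * t + 0) else z2 (2 * t + -1))" for t
  \<comment> \<open>The shift \<open>l1 1 - l2 0\<close> makes the two branches agree at
    1/2.\<close>
  define l where "l t = (if t \<le> 1/2 then l1 (2 * t) else l2 (2 * t - 1) + l1 1 - l2 0)" for t
  have "(max (A1 * \<bar>2\<bar>) (A2 * \<bar>2\<bar>))-lipschitz_on {0..1} \<gamma>"
    unfolding \<gamma>_def
    by (intro lipschitz_on_concat_max lipschitz_on_affine_comp[OF L1(1)]
        lipschitz_on_affine_comp[OF L2(1)]) (use e1 e2 in auto)
  moreover have "(max (B1 * \<bar>2\<bar>) (B2 * \<bar>2\<bar>))-lipschitz_on {0..1} z"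
    unfolding z_def
    by (intro lipschitz_on_concat_max lipschitz_on_affine_comp[OF L1(2)]
        lipschitz_on_affine_comp[OF L2(2)]) (use e1 e2 in auto)
  moreover have "negligible N"
    unfolding N_def by (intro negligible_Un negligible_affine_image N1 N2) auto
  moreover have "\<exists>g'. (\<gamma> has_vector_derivative g') (at t) \<and>
      (z has_real_derivative \<omega> (\<gamma> t) g') (at t)" if t: "t \<in> {0..1} - N" for t
  proof -
    consider "t < 1/2" | "t > 1/2"
      using t unfolding N_def by fastforce
    then show ?thesis
    proof cases
      case 1
      have "2 * t + 0 \<notin> N1"
      proof
        assume "2 * t + 0 \<in> N1"
        then have "(1/2) * (2 * t + 0) + 0 \<in> N"
          unfolding N_def by blast
        with t show False by simp
      qed
      with t 1 have "2 * t + 0 \<in> {0..1} - N1"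
        by simp
      then obtain g' where g': "((\<lambda>t. \<gamma>1 (2 * t + 0)) has_vector_derivative g') (at t)"
        "((\<lambda>t. z1 (2 * t + 0)) has_real_derivative \<omega> (\<gamma>1 (2 * t + 0)) g') (at t)"
        using N1(2) horizontal_derivative_affine_comp by blast
      have "(\<gamma> has_vector_derivative g') (at t)"
        by (rule has_vector_derivative_transform_within_open[OF g'(1), of "{..<1/2}"])
          (use 1 in \<open>auto simp: \<gamma>_def\<close>)
      moreover have "(z has_real_derivative \<omega> (\<gamma> t) g') (at t)"
        by (rule has_field_derivative_transform_within_open[of "\<lambda>t. z1 (2 * t + 0)" _ _ "{..<1/2}"])
          (use 1 g'(2) in \<open>auto simp: \<gamma>_def z_def\<close>)
      ultimately show ?thesis by blast
    next
      case 2
      have "2 * t + -1 \<notin> N2"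
      proof
        assume "2 * t + -1 \<in> N2"
        then have "(1/2) * (2 * t + -1) + 1/2 \<in> N"
          unfolding N_def by blast
        with t show False by (simp add: field_simps)
      qed
      with t 2 have "2 * t + -1 \<in> {0..1} - N2"
        by simp
      then obtain g' where g': "((\<lambda>t. \<gamma>2 (2 * t + -1)) has_vector_derivative g') (at t)"
        "((\<lambda>t. z2 (2 * t + -1)) has_real_derivative \<omega> (\<gamma>2 (2 * t + -1)) g') (at t)"
        using N2(2) horizontal_derivative_affine_comp by blast
      have "(\<gamma> has_vector_derivative g') (at t)"
        by (rule has_vector_derivative_transform_within_open[OF g'(1), of "{1/2<..}"])
          (use 2 in \<open>auto simp: \<gamma>_def\<close>)
      moreover have "(z has_real_derivative \<omega> (\<gamma> t) g') (at t)"
        by (rule has_field_derivative_transform_within_open[of "\<lambda>t. z2 (2 * t + -1)" _ _ "{1/2<..}"])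
          (use 2 g'(2) in \<open>auto simp: \<gamma>_def z_def\<close>)
      ultimately show ?thesis by blast
    qed
  qed
  ultimately have "horizontal_curve \<omega> \<gamma> z"
    unfolding horizontal_curve_iff by blast
  moreover have "length_control \<gamma> l"
    unfolding length_control_def
  proof (intro allI impI)
    fix s t :: real assume st: "0 \<le> s" "s \<le> t" "t \<le> 1"
    consider "t \<le> 1/2" | "s \<le> 1/2" "t > 1/2" | "s > 1/2"
      by linarith
    then show "dist (\<gamma> s) (\<gamma> t) \<le> l t - l s"
    proof cases
      case 1
      with st show ?thesis
        using length_controlD[OF l1(1), of "2 * s" "2 * t"] by (simp add: \<gamma>_def l_def)
    next
      case 2
      with st have "dist (\<gamma>1 (2 * s)) (\<gamma>1 1) \<le> l1 1 - l1 (2 * s)"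
        "dist (\<gamma>2 0) (\<gamma>2 (2 * t - 1)) \<le> l2 (2 * t - 1) - l2 0"
        by (auto intro!: length_controlD[OF l1(1)] length_controlD[OF l2(1)])
      moreover have "\<gamma>1 1 = \<gamma>2 0"
        using e1 e2 by auto
      ultimately show ?thesis
        using 2 dist_triangle[of "\<gamma>1 (2 * s)" "\<gamma>2 (2 * t - 1)" "\<gamma>1 1"]
        by (simp add: \<gamma>_def l_def)
    next
      case 3
      with st show ?thesis
        using length_controlD[OF l2(1), of "2 * s - 1" "2 * t - 1"] by (simp add: \<gamma>_def l_def)
    qed
  qed
  moreover have "(\<gamma> 0, z 0) = u" "(\<gamma> 1, z 1) = w" "l 1 - l 0 \<le> L + L'"
    using e1 e2 l1(2) l2(2) by (auto simp: \<gamma>_def z_def l_def)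
  ultimately show ?thesis
    unfolding joined_def by blast
qed

section \<open>Explicit horizontal curves\<close>

lemma joined_segment: "joined (norm x) (a, s) (a + x, s + \<omega> a x)"
proof -
  let ?\<gamma> = "\<lambda>t. a + t *\<^sub>R x" and ?z = "\<lambda>t. s + t * \<omega> a x"
  have "(norm x)-lipschitz_on {0..1} ?\<gamma>"
    by (rule lipschitz_onI) (auto simp: dist_norm simp flip: scaleR_diff_left)
  moreover have "\<bar>\<omega> a x\<bar>-lipschitz_on {0..1} ?z"
    by (rule lipschitz_onI) (auto simp: dist_norm abs_mult simp flip: left_diff_distrib)
  moreover have "(?\<gamma> has_vector_derivative x) (at t)" for t
    by (auto intro!: derivative_eq_intros)
  \<comment> \<open>The slope is constant because \<open>\<omega> x x = 0\<close> removes the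
    dependence on \<open>t\<close>.\<close>
  moreover have "(?z has_real_derivative \<omega> (?\<gamma> t) x) (at t)" for t
    by (auto intro!: derivative_eq_intros simp: add_left scaleR_left)
  ultimately have "horizontal_curve \<omega> ?\<gamma> ?z"
    unfolding horizontal_curve_iff using negligible_empty by blast
  moreover have "length_control ?\<gamma> (\<lambda>t. t * norm x)"
    by (auto simp: length_control_def dist_norm simp flip: scaleR_diff_left left_diff_distrib)
  ultimately show ?thesis
    unfolding joined_def
    by (intro exI[of _ ?\<gamma>] exI[of _ ?z] exI[of _ "\<lambda>t. t * norm x"]) auto
qed

text \<open>The commutator of the horizontal vectors \<open>x\<close> and \<open>y\<close> is vertical.\<close>

lemma joined_commutator: "joined (2 * (norm x + norm y)) (a, s) (a, s + 2 * \<omega> x y)"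
proof -
  have "joined (norm x + norm y + norm (- x) + norm (- y)) (a, s)
    (a + x + y + - x + - y,
     s + \<omega> a x + \<omega> (a + x) y + \<omega> (a + x + y) (- x) + \<omega> (a + x + y + - x) (- y))"
    by (rule joined_trans[OF joined_trans[OF joined_trans[OF joined_segment joined_segment]
        joined_segment] joined_segment])
  moreover have "\<omega> a x + \<omega> (a + x) y + \<omega> (a + x + y) (- x) + \<omega> (a + x + y + - x) (- y) = 2 * \<omega> x y"
    using antisym[of y x] by (simp add: add_left minus_right)
  ultimately show ?thesis
    by (simp add: add.assoc)
qed

text \<open>Commutators gain height quadratically in the size of the vectors, so a height
  \<open>t\<close> costs a length of order \<open>sqrt \<bar>t\<bar>\<close>.\<close>

lemma ex_joined_vertical:
  obtains C where "0 \<le> C" "\<And>a s t. joined (C * sqrt \<bar>t\<bar>) (a, s) (a, s + t)"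
proof -
  obtain e f where ef: "\<omega> e f \<noteq> 0"
    using nonnull by blast
  define C where "C = 2 * (norm e + norm f / (2 * \<bar>\<omega> e f\<bar>))"
  have "joined (C * sqrt \<bar>t\<bar>) (a, s) (a, s + t)" for a s t
  proof -
    define x where "x = sqrt \<bar>t\<bar> *\<^sub>R e"
    \<comment> \<open>The coefficient is the one for which \<open>2 * \<omega> x y = t\<close>. For
      \<open>t = 0\<close> the division by zero yields 0, which is the right value.\<close>
    define y where "y = (t / (2 * \<omega> e f * sqrt \<bar>t\<bar>)) *\<^sub>R f"
    have "2 * \<omega> x y = t"
      using ef by (simp add: x_def y_def scaleR_left scaleR_right)
    have "\<bar>t\<bar> / sqrt \<bar>t\<bar> = sqrt \<bar>t\<bar>"
      by (simp add: real_div_sqrt)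
    moreover have "norm y = norm f / (2 * \<bar>\<omega> e f\<bar>) * (\<bar>t\<bar> / sqrt \<bar>t\<bar>)"
      by (simp add: y_def abs_mult)
    ultimately have "2 * (norm x + norm y) = C * sqrt \<bar>t\<bar>"
      by (simp add: x_def C_def algebra_simps)
    with \<open>2 * \<omega> x y = t\<close> show ?thesis
      using joined_commutator[of x y a s] by simp
  qed
  moreover have "0 \<le> C"
    by (simp add: C_def)
  ultimately show ?thesis
    using that by blast
qed

text \<open>First a straight segment to \<open>fst v\<close>, then a vertical correction: the
  segment ends at a height that differs from \<open>snd v\<close> by exactly
  \<open>vert u v\<close>.\<close>

lemma ex_joined:
  obtains C where "0 \<le> C" "\<And>u v. joined (norm (fst v - fst u) + C * sqrt \<bar>vert u v\<bar>) u v"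
proof -
  obtain C where C: "0 \<le> C" "\<And>a s t. joined (C * sqrt \<bar>t\<bar>) (a, s) (a, s + t)"
    using ex_joined_vertical by blast
  have "joined (norm (fst v - fst u) + C * sqrt \<bar>vert u v\<bar>) u v" for u v
  proof -
    have "joined (norm (fst v - fst u)) u (fst v, snd u + \<omega> (fst u) (fst v))"
      using joined_segment[of "fst v - fst u" "fst u" "snd u"] by (simp add: diff_right)
    from joined_trans[OF this C(2)[of "vert u v"]] show ?thesis
      by (simp add: vert_def)
  qed
  with C(1) that show ?thesis by blast
qed

section \<open>From joining curves to the infimum\<close>

lemma cc_dist_le:
  assumes "joined L u v"
  shows "cc_dist \<omega> u v \<le> L"
proof -
  from assms obtain \<gamma> z l where h: "horizontal_curve \<omega> \<gamma> z"
    and e: "(\<gamma> 0, z 0) = u" "(\<gamma> 1, z 1) = v" and l: "length_control \<gamma> l" "l 1 - l 0 \<le> L"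
    unfolding joined_def by blast
  have L: "0 \<le> L"
    using length_control_mono[OF l(1), of 0 1] l(2) by simp
  have "(INF (\<gamma>, z) \<in> {(\<gamma>, z). horizontal_curve \<omega> \<gamma> z \<and> (\<gamma> 0, z 0) = u \<and> (\<gamma> 1, z 1) = v}.
      curve_length \<gamma>) \<le> curve_length \<gamma>"
    by (rule INF_lower2[of "(\<gamma>, z)"]) (use h e in auto)
  also have "\<dots> \<le> ennreal L"
    using curve_length_le_control[OF l(1)] ennreal_leI[OF l(2)] by (rule order_trans)
  finally show ?thesis
    unfolding cc_dist_def by (rule enn2real_leI[OF L])
qed

lemma joined_if_cc_dist_less:
  assumes "cc_dist \<omega> u v < L"
  shows "joined L u v"
proof -
  let ?S = "{(\<gamma>, z). horizontal_curve \<omega> \<gamma> z \<and> (\<gamma> 0, z 0) = u \<and> (\<gamma> 1, z 1) = v}"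
  let ?I = "INF (\<gamma>, z) \<in> ?S. curve_length \<gamma>"
  \<comment> \<open>\<open>enn2real\<close> would send an infinite infimum to 0, so finiteness is
    shown first, from any one joining curve.\<close>
  obtain L' where "joined L' u v"
    using ex_joined by blast
  then obtain \<gamma> z l where h: "horizontal_curve \<omega> \<gamma> z"
    and e: "(\<gamma> 0, z 0) = u" "(\<gamma> 1, z 1) = v" and l: "length_control \<gamma> l"
    unfolding joined_def by blast
  have "?I \<le> curve_length \<gamma>"
    by (rule INF_lower2[of "(\<gamma>, z)"]) (use h e in auto)
  also have "\<dots> < \<infinity>"
    using curve_length_le_control[OF l] by (simp add: le_less_trans)
  finally have "?I = ennreal (cc_dist \<omega> u v)"
    unfolding cc_dist_def by (intro ennreal_enn2real[symmetric]) simp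
  also have "\<dots> < ennreal L"
    using assms by (intro ennreal_lessI) (auto simp: cc_dist_def intro: le_less_trans[rotated])
  finally obtain \<gamma> z where h: "horizontal_curve \<omega> \<gamma> z"
    and e: "(\<gamma> 0, z 0) = u" "(\<gamma> 1, z 1) = v" and c: "curve_length \<gamma> < ennreal L"
    unfolding INF_less_iff by auto
  have "curve_length \<gamma> < \<infinity>"
    using c by (auto intro: less_trans)
  then obtain l where l: "length_control \<gamma> l" "l 1 - l 0 \<le> enn2real (curve_length \<gamma>)"
    using exists_length_control by blast
  have "0 \<le> L"
    using assms by (auto simp: cc_dist_def intro: order_trans[OF enn2real_nonneg less_imp_le])
  then have "enn2real (curve_length \<gamma>) \<le> L"
    using c by (intro enn2real_leI) auto
  with l(2) have "l 1 - l 0 \<le> L"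
    by linarith
  with h e l(1) show ?thesis
    unfolding joined_def by blast
qed

end

section \<open>The vertical displacement of a horizontal curve\<close>

lemma negligible_gauge_content_less:
  assumes "negligible N" "\<epsilon> > 0"
  shows "\<exists>\<gamma>. gauge \<gamma> \<and> (\<forall>\<D>. \<D> tagged_division_of {a..b::real} \<and> \<gamma> fine \<D> \<longrightarrow>
    (\<Sum>(x, K)\<in>\<D>. measure lborel K * indicat_real N x) < \<epsilon>)"
proof -
  \<comment> \<open>The sum in question is a Riemann sum of the indicator, whose gauge integral is
    0.\<close>
  have "(indicat_real N has_integral 0) {a..b}"
    using assms(1) by (auto simp: negligible_def)
  from this[unfolded has_integral_real, rule_format, OF assms(2)]
  obtain \<gamma> where \<gamma>: "gauge \<gamma>"
    "\<forall>\<D>. \<D> tagged_division_of {a..b} \<and> \<gamma> fine \<D> \<longrightarrow>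
      norm ((\<Sum>(x, K)\<in>\<D>. measure lborel K *\<^sub>R indicat_real N x) - 0) < \<epsilon>"
    by (elim exE conjE)
  show ?thesis
  proof (intro exI conjI allI impI)
    show "gauge \<gamma>" by (rule \<gamma>(1))
    fix \<D> assume "\<D> tagged_division_of {a..b} \<and> \<gamma> fine \<D>"
    from \<gamma>(2)[rule_format, OF this] show "(\<Sum>(x, K)\<in>\<D>. measure lborel K * indicat_real N x) < \<epsilon>"
      by simp
  qed
qed

text \<open>No integration is needed: on a fine tagged division the increments of \<open>\<zeta>\<close> are, up to
  \<open>\<epsilon>\<close>, bounded by those of \<open>l\<close>, except at tags in the negligible set \<open>N\<close>, where the Lipschitz
  bound is used.\<close>

lemma increment_le_of_local_bound:
  fixes \<zeta> l :: "real \<Rightarrow> real"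
  assumes N: "negligible N" and M: "M-lipschitz_on {0..1} \<zeta>"
    and l: "\<And>s t. 0 \<le> s \<Longrightarrow> s \<le> t \<Longrightarrow> t \<le> 1 \<Longrightarrow> l s \<le> l t"
    and loc: "\<And>t \<epsilon>. t \<in> {0..1} - N \<Longrightarrow> \<epsilon> > 0 \<Longrightarrow>
      \<exists>\<delta>>0. \<forall>y \<in> {0..1}. \<bar>y - t\<bar> < \<delta> \<longrightarrow> \<bar>\<zeta> y - \<zeta> t\<bar> \<le> \<bar>l y - l t\<bar> + \<epsilon> * \<bar>y - t\<bar>"
  shows "\<bar>\<zeta> 1 - \<zeta> 0\<bar> \<le> l 1 - l 0"
proof (rule field_le_epsilon)
  fix e :: real assume e: "e > 0"
  have M0: "0 \<le> M"
    by (rule lipschitz_on_nonneg[OF M])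
  \<comment> \<open>In the total error, \<open>\<epsilon>\<close> arises because the lengths of the
    intervals add up to 1, and \<open>M * \<epsilon>\<close> from the tags in
    \<open>N\<close>.\<close>
  define \<epsilon> where "\<epsilon> = e / (1 + M)"
  have \<epsilon>: "\<epsilon> > 0"
    using e M0 by (simp add: \<epsilon>_def)
  have "1 + M \<noteq> 0"
    using M0 by linarith
  then have "\<epsilon> * (1 + M) = e"
    by (simp add: \<epsilon>_def)
  let ?P = "\<lambda>t \<delta>. \<delta> > 0 \<and> (t \<in> {0..1} - N \<longrightarrow>
      (\<forall>y \<in> {0..1}. \<bar>y - t\<bar> < \<delta> \<longrightarrow> \<bar>\<zeta> y - \<zeta> t\<bar> \<le> \<bar>l y - l t\<bar> + \<epsilon> * \<bar>y - t\<bar>))"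
  \<comment> \<open>A gauge needs a positive radius at every point; where \<open>loc\<close> says
    nothing, any radius such as 1 serves.\<close>
  have "\<forall>t. \<exists>\<delta>. ?P t \<delta>"
  proof
    fix t show "\<exists>\<delta>. ?P t \<delta>"
      using loc[of t, OF _ \<epsilon>] zero_less_one by (cases "t \<in> {0..1} - N") blast+
  qed
  then obtain \<delta> where "\<forall>t. ?P t (\<delta> t)"
    by (rule choice[THEN exE])
  then have \<delta>: "\<delta> t > 0"
    "t \<in> {0..1} - N \<Longrightarrow> y \<in> {0..1} \<Longrightarrow> \<bar>y - t\<bar> < \<delta> t \<Longrightarrow> \<bar>\<zeta> y - \<zeta> t\<bar> \<le> \<bar>l y - l t\<bar> + \<epsilon> * \<bar>y - t\<bar>" for t y
    by blast+
  from negligible_gauge_content_less[OF N \<epsilon>, of 0 1]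
  obtain \<gamma> where \<gamma>: "gauge \<gamma>"
    "\<forall>\<D>. \<D> tagged_division_of {0..1} \<and> \<gamma> fine \<D> \<longrightarrow>
       (\<Sum>(x, K)\<in>\<D>. measure lborel K * indicat_real N x) < \<epsilon>"
    by (elim exE conjE)
  have "gauge (\<lambda>x. \<gamma> x \<inter> ball x (\<delta> x))"
    using \<gamma>(1) \<delta>(1) by (intro gauge_Int gauge_ball_dependent) auto
  then obtain \<D> where \<D>: "\<D> tagged_division_of {0..1}" "(\<lambda>x. \<gamma> x \<inter> ball x (\<delta> x)) fine \<D>"
    using fine_division_exists_real by blast
  then have fine: "\<gamma> fine \<D>" "(\<lambda>x. ball x (\<delta> x)) fine \<D>"
    by (simp_all add: fine_Int)
  have local_bound: "\<bar>\<zeta> (Sup K) - \<zeta> (Inf K)\<bar>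
      \<le> (l (Sup K) - l (Inf K)) + \<epsilon> * (Sup K - Inf K) + M * (measure lborel K * indicat_real N x)"
    if xK: "(x, K) \<in> \<D>" for x K
  proof -
    obtain a b where K: "K = {a..b}"
      using tagged_division_ofD(4)[OF \<D>(1) xK] by auto
    have x: "a \<le> x" "x \<le> b" "0 \<le> a" "b \<le> 1"
      using tagged_division_ofD(2,3)[OF \<D>(1) xK] K by auto
    have "a \<in> K" "b \<in> K"
      using K x by auto
    then have "a \<in> ball x (\<delta> x)" "b \<in> ball x (\<delta> x)"
      using fineD[OF fine(2) xK] by blast+
    then have near: "\<bar>a - x\<bar> < \<delta> x" "\<bar>b - x\<bar> < \<delta> x"
      by (simp_all add: dist_real_def abs_minus_commute)
    have SI: "Sup K = b" "Inf K = a" "measure lborel K = b - a"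
      using K x by auto
    have la: "l a \<le> l x" "l x \<le> l b"
      using x by (auto intro: l)
    show ?thesis
    proof (cases "x \<in> N")
      case True
      have "\<bar>\<zeta> b - \<zeta> a\<bar> \<le> M * (b - a)"
        using lipschitz_onD[OF M, of b a] x by (simp add: dist_real_def)
      moreover have "0 \<le> \<epsilon> * (b - a)"
        using \<epsilon> x by simp
      ultimately show ?thesis
        using True la by (simp add: SI)
    next
      case False
      then have "x \<in> {0..1} - N" "a \<in> {0..1}" "b \<in> {0..1}"
        using x by auto
      \<comment> \<open>The increment is split at the tag. As \<open>l\<close> is monotone and the
        tag lies between \<open>a\<close> and \<open>b\<close>, the two increments of
        \<open>l\<close> add up without loss.\<close>
      note \<delta>(2)[OF this(1,2) near(1)] \<delta>(2)[OF this(1,3) near(2)]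
      moreover have "\<epsilon> * \<bar>a - x\<bar> + \<epsilon> * \<bar>b - x\<bar> = \<epsilon> * (b - a)"
        using x by (simp add: algebra_simps)
      ultimately show ?thesis
        using False la by (simp add: SI)
    qed
  qed
  have "\<bar>\<zeta> 1 - \<zeta> 0\<bar> = \<bar>\<Sum>(x, K)\<in>\<D>. \<zeta> (Sup K) - \<zeta> (Inf K)\<bar>"
    by (subst additive_tagged_division_1[OF _ \<D>(1)]) auto
  also have "\<dots> \<le> (\<Sum>(x, K)\<in>\<D>. \<bar>\<zeta> (Sup K) - \<zeta> (Inf K)\<bar>)"
    by (rule order_trans[OF sum_abs]) (simp add: case_prod_unfold)
  also have "\<dots> \<le> (\<Sum>(x, K)\<in>\<D>. (l (Sup K) - l (Inf K)) + \<epsilon> * (Sup K - Inf K)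
      + M * (measure lborel K * indicat_real N x))"
    by (rule sum_mono) (use local_bound in auto)
  also have "\<dots> = (\<Sum>(x, K)\<in>\<D>. l (Sup K) - l (Inf K)) + \<epsilon> * (\<Sum>(x, K)\<in>\<D>. Sup K - Inf K)
      + M * (\<Sum>(x, K)\<in>\<D>. measure lborel K * indicat_real N x)"
    by (simp add: case_prod_unfold sum.distrib sum_distrib_left)
  also have "\<dots> = (l 1 - l 0) + \<epsilon> + M * (\<Sum>(x, K)\<in>\<D>. measure lborel K * indicat_real N x)"
    using additive_tagged_division_1[OF _ \<D>(1), of l] additive_tagged_division_1[OF _ \<D>(1), of "\<lambda>x. x"]
    by simp
  also have "\<dots> \<le> (l 1 - l 0) + \<epsilon> + M * \<epsilon>"
    using \<gamma>(2)[rule_format, OF conjI, OF \<D>(1) fine(1)] M0 by (intro add_left_mono mult_left_mono) auto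
  also have "\<dots> = l 1 - l 0 + e"
    using \<open>\<epsilon> * (1 + M) = e\<close> by (simp add: algebra_simps)
  finally show "\<bar>\<zeta> 1 - \<zeta> 0\<bar> \<le> l 1 - l 0 + e" .
qed

context nonnull_alternating_form
begin

lemma joined_dist_le:
  assumes "joined L u v"
  shows "norm (fst v - fst u) \<le> L"
proof -
  from assms obtain \<gamma> z l where "horizontal_curve \<omega> \<gamma> z" and e: "(\<gamma> 0, z 0) = u" "(\<gamma> 1, z 1) = v"
    and l: "length_control \<gamma> l" "l 1 - l 0 \<le> L"
    unfolding joined_def by blast
  have "dist (\<gamma> 0) (\<gamma> 1) \<le> l 1 - l 0"
    by (rule length_controlD[OF l(1)]) auto
  with l e show ?thesis
    by (auto simp: dist_norm norm_minus_commute)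
qed

text \<open>Subtracting \<open>\<omega> (\<gamma> 0) (\<gamma> t)\<close> from \<open>z\<close>
  leaves the derivative \<open>\<omega> (\<gamma> t - \<gamma> 0) g'\<close>, whose first argument
  has norm at most \<open>L\<close>. The total change is therefore at most \<open>K * L\<close>
  times the length.\<close>

lemma joined_vert_le:
  assumes K: "0 \<le> K" "\<And>x y. \<bar>\<omega> x y\<bar> \<le> norm x * norm y * K" and "joined L u v"
  shows "\<bar>vert u v\<bar> \<le> K * L\<^sup>2"
proof -
  from assms(3) obtain \<gamma> z l where h: "horizontal_curve \<omega> \<gamma> z"
    and e: "(\<gamma> 0, z 0) = u" "(\<gamma> 1, z 1) = v" and l: "length_control \<gamma> l" "l 1 - l 0 \<le> L"
    unfolding joined_def by blast
  from h obtain N L1 L2 where N: "negligible N"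
    "\<And>t. t \<in> {0..1} - N \<Longrightarrow> \<exists>g'. (\<gamma> has_vector_derivative g') (at t) \<and>
        (z has_real_derivative \<omega> (\<gamma> t) g') (at t)"
    and L: "L1-lipschitz_on {0..1} \<gamma>" "L2-lipschitz_on {0..1} z"
    unfolding horizontal_curve_iff by blast
  have lmono: "l s \<le> l t" if "0 \<le> s" "s \<le> t" "t \<le> 1" for s t
    using length_control_mono[OF l(1)] that .
  have L0: "0 \<le> L"
    using lmono[of 0 1] l(2) by simp
  define \<zeta> where "\<zeta> t = z t - \<omega> (\<gamma> 0) (\<gamma> t)" for t
  have "\<bar>\<zeta> 1 - \<zeta> 0\<bar> \<le> K * L * l 1 - K * L * l 0"
  proof (rule increment_le_of_local_bound[OF N(1), where l = "\<lambda>t. K * L * l t"])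
    show "(L2 + norm (\<gamma> 0) * L1 * K)-lipschitz_on {0..1} \<zeta>"
    proof (rule lipschitz_onI)
      fix s t :: real assume st: "s \<in> {0..1}" "t \<in> {0..1}"
      have "dist (\<zeta> s) (\<zeta> t) \<le> dist (z s) (z t) + \<bar>\<omega> (\<gamma> 0) (\<gamma> s - \<gamma> t)\<bar>"
        unfolding \<zeta>_def dist_real_def diff_right by linarith
      also have "\<dots> \<le> L2 * dist s t + norm (\<gamma> 0) * (L1 * dist s t) * K"
      proof (rule add_mono)
        show "dist (z s) (z t) \<le> L2 * dist s t"
          by (rule lipschitz_onD[OF L(2) st])
        have "\<bar>\<omega> (\<gamma> 0) (\<gamma> s - \<gamma> t)\<bar> \<le> norm (\<gamma> 0) * norm (\<gamma> s - \<gamma> t) * K"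
          by (rule K)
        also have "\<dots> \<le> norm (\<gamma> 0) * (L1 * dist s t) * K"
          using lipschitz_onD[OF L(1) st]
          by (intro mult_right_mono mult_left_mono K) (auto simp: dist_norm)
        finally show "\<bar>\<omega> (\<gamma> 0) (\<gamma> s - \<gamma> t)\<bar> \<le> norm (\<gamma> 0) * (L1 * dist s t) * K" .
      qed
      finally show "dist (\<zeta> s) (\<zeta> t) \<le> (L2 + norm (\<gamma> 0) * L1 * K) * dist s t"
        by (simp add: algebra_simps)
    next
      show "0 \<le> L2 + norm (\<gamma> 0) * L1 * K"
        using lipschitz_on_nonneg[OF L(1)] lipschitz_on_nonneg[OF L(2)] K(1) by simp
    qed
  next
    fix s t :: real assume "0 \<le> s" "s \<le> t" "t \<le> 1"
    then show "K * L * l s \<le> K * L * l t"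
      using K(1) L0 by (intro mult_left_mono lmono) auto
  next
    fix t \<epsilon> :: real assume t: "t \<in> {0..1} - N" and \<epsilon>: "\<epsilon> > 0"
    obtain g' where g': "(\<gamma> has_vector_derivative g') (at t)" "(z has_real_derivative \<omega> (\<gamma> t) g') (at t)"
      using N(2)[OF t] by blast
    \<comment> \<open>Freezing the first argument at \<open>\<gamma> t\<close> cancels the
      derivative of \<open>z\<close> at \<open>t\<close>. From \<open>t\<close> to \<open>y\<close>
      the increments of \<open>\<zeta>\<close> and \<open>?h\<close> differ by
      \<open>\<omega> (\<gamma> t - \<gamma> 0) (\<gamma> y - \<gamma> t)\<close>, which
      \<open>l\<close> controls.\<close>
    let ?h = "\<lambda>y. z y - \<omega> (\<gamma> t) (\<gamma> y)"
    have "((\<lambda>y. \<omega> (\<gamma> t) (\<gamma> y)) has_vector_derivative \<omega> (\<gamma> t) g') (at t)"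
      by (rule bounded_linear.has_vector_derivative[OF bounded_linear_right g'(1)])
    then have "(?h has_vector_derivative (\<omega> (\<gamma> t) g' - \<omega> (\<gamma> t) g')) (at t)"
      using g'(2) unfolding has_real_derivative_iff_has_vector_derivative
      by (intro has_vector_derivative_diff)
    then have "(?h has_derivative (\<lambda>_. 0)) (at t)"
      by (simp add: has_vector_derivative_def)
    then obtain \<delta> where \<delta>: "\<delta> > 0"
      "\<And>y. norm (y - t) < \<delta> \<Longrightarrow> norm (?h y - ?h t - 0) \<le> \<epsilon> * norm (y - t)"
      unfolding has_derivative_at_alt using \<epsilon> by blast
    have "\<bar>\<zeta> y - \<zeta> t\<bar> \<le> \<bar>K * L * l y - K * L * l t\<bar> + \<epsilon> * \<bar>y - t\<bar>"
      if y: "y \<in> {0..1}" "\<bar>y - t\<bar> < \<delta>" for y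
    proof -
      have "\<zeta> y - \<zeta> t = (?h y - ?h t) + \<omega> (\<gamma> t - \<gamma> 0) (\<gamma> y - \<gamma> t)"
        by (simp add: \<zeta>_def diff_left diff_right)
      moreover have "\<bar>?h y - ?h t\<bar> \<le> \<epsilon> * \<bar>y - t\<bar>"
        using \<delta>(2)[of y] y by simp
      moreover have "\<bar>\<omega> (\<gamma> t - \<gamma> 0) (\<gamma> y - \<gamma> t)\<bar> \<le> \<bar>K * L * l y - K * L * l t\<bar>"
      proof -
        have "norm (\<gamma> t - \<gamma> 0) \<le> l t - l 0"
          using length_controlD[OF l(1), of 0 t] t by (simp add: dist_norm norm_minus_commute)
        also have "\<dots> \<le> L"
          using lmono[of t 1] t l(2) by auto
        finally have 1: "norm (\<gamma> t - \<gamma> 0) \<le> L" .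
        have 2: "norm (\<gamma> y - \<gamma> t) \<le> \<bar>l y - l t\<bar>"
          using length_controlD[OF l(1), of t y] length_controlD[OF l(1), of y t] t y
          by (cases "t \<le> y") (auto simp: dist_norm norm_minus_commute)
        have "\<bar>\<omega> (\<gamma> t - \<gamma> 0) (\<gamma> y - \<gamma> t)\<bar> \<le> norm (\<gamma> t - \<gamma> 0) * norm (\<gamma> y - \<gamma> t) * K"
          by (rule K)
        also have "\<dots> \<le> L * \<bar>l y - l t\<bar> * K"
          by (intro mult_right_mono mult_mono 1 2 L0 K) auto
        also have "\<dots> = \<bar>K * L * (l y - l t)\<bar>"
          using K(1) L0 by (simp add: abs_mult)
        finally show ?thesis
          by (simp add: right_diff_distrib)
      qed
      ultimately show ?thesis by linarith
    qed
    with \<delta>(1) show "\<exists>\<delta>>0. \<forall>y \<in> {0..1}. \<bar>y - t\<bar> < \<delta> \<longrightarrow>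
        \<bar>\<zeta> y - \<zeta> t\<bar> \<le> \<bar>K * L * l y - K * L * l t\<bar> + \<epsilon> * \<bar>y - t\<bar>"
      by blast
  qed
  moreover have "\<zeta> 1 - \<zeta> 0 = vert u v"
    using e by (auto simp: \<zeta>_def vert_def)
  ultimately have "\<bar>vert u v\<bar> \<le> K * L * (l 1 - l 0)"
    by (simp add: right_diff_distrib)
  also have "\<dots> \<le> K * L * L"
    using K(1) L0 l(2) by (intro mult_left_mono) auto
  finally show ?thesis
    by (simp add: power2_eq_square mult.assoc)
qed

section \<open>Comparison with horizontal and vertical displacement; metric axioms\<close>

lemma norm_diff_le_cc_dist: "norm (fst v - fst u) \<le> cc_dist \<omega> u v"
  by (rule dense_ge) (auto intro: joined_dist_le joined_if_cc_dist_less)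

lemma ex_vert_le_cc_dist:
  obtains K where "\<And>u v. \<bar>vert u v\<bar> \<le> K * (cc_dist \<omega> u v)\<^sup>2"
proof -
  obtain K where K: "0 \<le> K" "\<And>x y. \<bar>\<omega> x y\<bar> \<le> norm x * norm y * K"
    using nonneg_bounded by auto
  have "\<bar>vert u v\<bar> \<le> K * (cc_dist \<omega> u v)\<^sup>2" for u v
  \<comment> \<open>The infimum need not be attained, so the bound for curves is passed to the limit
    as \<open>L\<close> decreases to the distance.\<close>
  proof (rule tendsto_lowerbound)
    show "((\<lambda>L. K * L\<^sup>2) \<longlongrightarrow> K * (cc_dist \<omega> u v)\<^sup>2) (at_right (cc_dist \<omega> u v))"
      by (intro tendsto_intros)
    show "\<forall>\<^sub>F L in at_right (cc_dist \<omega> u v). \<bar>vert u v\<bar> \<le> K * L\<^sup>2"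
      unfolding eventually_at_right_field
      by (intro exI[of _ "cc_dist \<omega> u v + 1"]) (auto intro: joined_vert_le[OF K] joined_if_cc_dist_less)
  qed simp
  with that show ?thesis by blast
qed

lemma Metric_space_cc_dist: "Metric_space UNIV (cc_dist \<omega>)"
proof
  fix u v w :: "'a \<times> real"
  show "0 \<le> cc_dist \<omega> u v"
    by (simp add: cc_dist_def)
  have le: "cc_dist \<omega> v u \<le> cc_dist \<omega> u v" for u v
    by (rule dense_ge) (auto intro: cc_dist_le joined_sym joined_if_cc_dist_less)
  then show "cc_dist \<omega> u v = cc_dist \<omega> v u"
    by (intro antisym_conv[THEN iffD1]) auto
  show "cc_dist \<omega> u v = 0 \<longleftrightarrow> u = v"
  proof
    assume "cc_dist \<omega> u v = 0"
    moreover obtain K where "\<bar>vert u v\<bar> \<le> K * (cc_dist \<omega> u v)\<^sup>2"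
      using ex_vert_le_cc_dist by blast
    ultimately have "fst v = fst u" "vert u v = 0"
      using norm_diff_le_cc_dist[of v u] by auto
    then show "u = v"
      by (auto simp: vert_def prod_eq_iff)
  next
    assume "u = v"
    then have "cc_dist \<omega> u v \<le> norm (0::'a)"
      using joined_segment[of 0 "fst u" "snd u"] by (intro cc_dist_le) (auto simp: zero_right)
    then show "cc_dist \<omega> u v = 0"
      by (simp add: cc_dist_def order_antisym)
  qed
  show "cc_dist \<omega> u w \<le> cc_dist \<omega> u v + cc_dist \<omega> v w"
  proof (rule field_le_epsilon)
    fix e :: real assume "e > 0"
    then have "joined (cc_dist \<omega> u v + e / 2) u v" "joined (cc_dist \<omega> v w + e / 2) v w"
      by (auto intro: joined_if_cc_dist_less)
    from cc_dist_le[OF joined_trans[OF this]]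
    show "cc_dist \<omega> u w \<le> cc_dist \<omega> u v + cc_dist \<omega> v w + e"
      by simp
  qed
qed

lemma ex_cc_dist_le:
  obtains C where "0 \<le> C" "\<And>u v. cc_dist \<omega> u v \<le> norm (fst v - fst u) + C * sqrt \<bar>vert u v\<bar>"
proof -
  obtain C where "0 \<le> C" "\<And>u v. joined (norm (fst v - fst u) + C * sqrt \<bar>vert u v\<bar>) u v"
    using ex_joined by blast
  with cc_dist_le that show ?thesis by blast
qed

end

section \<open>Property beta and the projection to the horizontal part\<close>

text \<open>Homogeneous form of the property. The gain is stated for p-th powers so that gains from
  successive scales add up, and with sums because \<open>a\<close> and \<open>b j\<close> will be
  consecutive displacements.\<close>

definition midpoint_beta :: "'a::real_normed_vector itself \<Rightarrow> real \<Rightarrow> real \<Rightarrow> bool" where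
  "midpoint_beta _ p c \<longleftrightarrow>
     (\<forall>A \<delta> (a::'a) (b :: nat \<Rightarrow> 'a).
        norm a \<le> A \<longrightarrow> (\<forall>n. norm (b n) \<le> A) \<longrightarrow> \<delta> > 0 \<longrightarrow>
        (\<forall>i j. i \<noteq> j \<longrightarrow> \<delta> \<le> norm (b i - b j)) \<longrightarrow>
        (\<exists>j. (norm (a + b j) / 2) powr p + \<delta> powr p / c \<le> A powr p))"

lemma midpoint_betaD:
  fixes a :: "'a::real_normed_vector" and b :: "nat \<Rightarrow> 'a"
  assumes "midpoint_beta TYPE('a) p c" "norm a \<le> A" "\<And>n. norm (b n) \<le> A" "\<delta> > 0"
    and "\<And>i j. i \<noteq> j \<Longrightarrow> \<delta> \<le> norm (b i - b j)"
  shows "\<exists>j. (norm (a + b j) / 2) powr p + \<delta> powr p / c \<le> A powr p"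
  using assms(1)[unfolded midpoint_beta_def, rule_format, OF assms(2-5)] .

text \<open>After scaling by \<open>A\<close> the half-sum has norm at most 1 - u with u =
  \<open>t powr p / c\<close>. Since u lies in [0,1] and \<open>1 \<le> p\<close>, the p-th power of
  1 - u is at most 1 - u.\<close>

lemma property_beta_imp_midpoint_beta:
  assumes "property_beta TYPE('a::banach) p" and p: "1 \<le> p"
  shows "\<exists>c>0. midpoint_beta TYPE('a) p c"
proof -
  from assms(1)[unfolded property_beta_def] obtain c \<beta> where c: "c > 0"
    and \<beta>: "\<forall>t>0. \<beta> t \<ge> t powr p / c"
    and conv: "\<forall>t>0. \<forall>z \<in> cball 0 1. \<forall>x :: nat \<Rightarrow> 'a.
      range x \<subseteq> cball 0 1 \<and> (INF (i, j) \<in> {(i, j). i \<noteq> j}. norm (x i - x j)) \<ge> t \<longrightarrow>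
      (\<exists>i. norm ((z - x i) /\<^sub>R 2) \<le> 1 - \<beta> t)"
    by (elim exE conjE)
  have "midpoint_beta TYPE('a) p c"
    unfolding midpoint_beta_def
  proof (intro allI impI)
    fix A \<delta> and a :: 'a and b :: "nat \<Rightarrow> 'a"
    assume a: "norm a \<le> A" and "\<forall>n. norm (b n) \<le> A" and \<delta>: "\<delta> > 0"
      and "\<forall>i j. i \<noteq> j \<longrightarrow> \<delta> \<le> norm (b i - b j)"
    then have b: "norm (b n) \<le> A" and sep: "i \<noteq> j \<Longrightarrow> \<delta> \<le> norm (b i - b j)" for n i j
      by auto
    have "\<delta> \<le> norm (b 0 - b 1)"
      by (rule sep) simp
    then have A: "A > 0"
      using norm_triangle_ineq4[of "b 0" "b 1"] b[of 0] b[of 1] \<delta> by linarith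
    define t where "t = \<delta> / A"
    have t: "t > 0"
      using A \<delta> by (simp add: t_def)
    \<comment> \<open>The sign turns the half-differences of \<open>property_beta\<close> into
      half-sums.\<close>
    let ?x = "\<lambda>n. - (b n /\<^sub>R A)"
    have "a /\<^sub>R A \<in> cball 0 1" "range ?x \<subseteq> cball 0 1"
      using A a b by (auto simp: field_simps)
    moreover have "(INF (i, j) \<in> {(i, j). i \<noteq> j}. norm (?x i - ?x j)) \<ge> t"
    proof (rule cINF_greatest)
      show "{(i, j). i \<noteq> (j::nat)} \<noteq> {}"
        by (auto intro: exI[of _ 0] exI[of _ 1])
      fix ij :: "nat \<times> nat" assume "ij \<in> {(i, j). i \<noteq> j}"
      then obtain i j where ij: "ij = (i, j)" "i \<noteq> j" by auto
      have "?x i - ?x j = - ((b i - b j) /\<^sub>R A)"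
        by (simp add: scaleR_diff_right)
      then have "norm (?x i - ?x j) = norm (b i - b j) / A"
        using A by (simp add: divide_inverse_commute)
      then show "t \<le> (case ij of (i, j) \<Rightarrow> norm (?x i - ?x j))"
        using sep[OF ij(2)] A ij(1) by (simp add: t_def divide_right_mono)
    qed
    ultimately obtain j where j: "norm ((a /\<^sub>R A - ?x j) /\<^sub>R 2) \<le> 1 - \<beta> t"
      using conv[rule_format, OF t _ conjI] by blast
    define q where "q = norm (a + b j) / 2 / A"
    have eq: "(a /\<^sub>R A - ?x j) /\<^sub>R 2 = (a + b j) /\<^sub>R (2 * A)"
      by (simp add: scaleR_add_right)
    have "norm ((a /\<^sub>R A - ?x j) /\<^sub>R 2) = q"
      using A by (simp only: eq norm_scaleR q_def, simp add: field_simps)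
    then have q: "q \<le> 1 - t powr p / c" "0 \<le> q"
      using j \<beta>[rule_format, OF t] A by (linarith, simp add: q_def)
    have "q powr p \<le> (1 - t powr p / c) powr p"
      using q p by (intro powr_mono2) auto
    also have "\<dots> \<le> (1 - t powr p / c) powr 1"
    proof (rule powr_mono'[OF p])
      have "0 \<le> t powr p / c"
        using c by simp
      then show "0 \<le> 1 - t powr p / c" "1 - t powr p / c \<le> 1"
        using q by linarith+
    qed
    also have "\<dots> = 1 - t powr p / c"
      using q by simp
    finally have "(q powr p + t powr p / c) * A powr p \<le> 1 * A powr p"
      by (intro mult_right_mono) auto
    moreover have "norm (a + b j) / 2 = q * A" "\<delta> = t * A"
      using A by (simp_all add: q_def t_def)
    ultimately show "\<exists>j. (norm (a + b j) / 2) powr p + \<delta> powr p / c \<le> A powr p"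
      using q(2) t A by (intro exI[of _ j]) (simp add: powr_mult algebra_simps)
  qed
  with c show ?thesis by blast
qed

section \<open>Convex blocks, Ramsey's theorem and small values of the form\<close>

lemma convex_hull_image_atLeast:
  fixes b :: "nat \<Rightarrow> 'a::real_vector"
  assumes "x \<in> convex hull (b ` {m..})"
  shows "\<exists>M>m. x \<in> convex hull (b ` {m..<M})"
proof -
  from assms obtain S u where S: "finite S" "S \<subseteq> b ` {m..}" "\<forall>v\<in>S. 0 \<le> u v" "sum u S = 1"
    "(\<Sum>v\<in>S. u v *\<^sub>R v) = x"
    unfolding convex_hull_explicit mem_Collect_eq by (elim exE conjE)
  obtain J where J: "J \<subseteq> {m..}" "finite J" "S = b ` J"
    using finite_subset_image[OF S(1,2)] by blast
  have "x \<in> convex hull S"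
    unfolding convex_hull_finite[OF S(1)] mem_Collect_eq using S(3-5) by (intro exI[of _ u] conjI)
  moreover have "J \<subseteq> {m..<Suc (Max (insert m J))}"
    using J by (auto simp: less_Suc_eq_le)
  then have "S \<subseteq> b ` {m..<Suc (Max (insert m J))}"
    using J(3) by blast
  ultimately have "x \<in> convex hull (b ` {m..<Suc (Max (insert m J))})"
    using hull_mono by blast
  moreover have "m < Suc (Max (insert m J))"
    using J(2) by (simp add: less_Suc_eq_le)
  ultimately show ?thesis by blast
qed

context nonnull_alternating_form
begin

lemma convex_form_ge: "convex {x. \<epsilon> \<le> \<omega> x y}" "convex {y. \<epsilon> \<le> \<omega> x y}"
proof -
  have *: "\<epsilon> \<le> u * s + v * t" if "\<epsilon> \<le> s" "\<epsilon> \<le> t" "0 \<le> u" "0 \<le> v" "u + v = 1" for s t u v :: real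
  proof -
    have "\<epsilon> = u * \<epsilon> + v * \<epsilon>"
      using that(5) by (simp flip: distrib_right)
    also have "\<dots> \<le> u * s + v * t"
      using that by (intro add_mono mult_left_mono) auto
    finally show ?thesis .
  qed
  show "convex {x. \<epsilon> \<le> \<omega> x y}" "convex {y. \<epsilon> \<le> \<omega> x y}"
    by (auto intro!: convexI * simp: add_left add_right scaleR_left scaleR_right)
qed

text \<open>Half-spaces are convex, so the lower bound spreads to the hulls in one variable at a
  time.\<close>

lemma form_ge_convex_hull:
  fixes b :: "nat \<Rightarrow> 'a"
  assumes ge: "\<And>i j. i < j \<Longrightarrow> \<epsilon> \<le> \<omega> (b i) (b j)"
    and x: "x \<in> convex hull (b ` {m..<M})" and y: "y \<in> convex hull (b ` {M..})"
  shows "\<epsilon> \<le> \<omega> x y"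
proof -
  have *: "\<epsilon> \<le> \<omega> x (b j)" if "M \<le> j" for j
  proof -
    have "convex hull (b ` {m..<M}) \<subseteq> {x. \<epsilon> \<le> \<omega> x (b j)}"
      using that by (intro hull_minimal convex_form_ge) (auto intro!: ge)
    with x show ?thesis by blast
  qed
  have "convex hull (b ` {M..}) \<subseteq> {y. \<epsilon> \<le> \<omega> x y}"
    by (intro hull_minimal convex_form_ge) (auto intro: *)
  with y show ?thesis by blast
qed

text \<open>Otherwise convex combinations of successive blocks of \<open>b\<close> would be uniformly separated;
  choosing them of almost minimal norm contradicts property \<open>(\<beta>)\<close>, because their midpoints
  are convex combinations of tails again.\<close>

lemma ex_form_less:
  fixes b :: "nat \<Rightarrow> 'a"
  assumes beta: "property_beta TYPE('a) p" "1 \<le> p"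
    and R: "\<And>n. norm (b n) \<le> R" and \<epsilon>: "\<epsilon> > 0"
  shows "\<exists>i j. i < j \<and> \<omega> (b i) (b j) < \<epsilon>"
proof (rule ccontr)
  assume "\<not> ?thesis"
  then have ge: "\<epsilon> \<le> \<omega> (b i) (b j)" if "i < j" for i j
    using that by force
  obtain c where c: "c > 0" "midpoint_beta TYPE('a) p c"
    using property_beta_imp_midpoint_beta[OF beta] by blast
  obtain K where K: "K > 0" "\<And>x y. norm (\<omega> x y) \<le> norm x * norm y * K"
    using pos_bounded by blast
  have R0: "0 \<le> R"
    by (rule order_trans[OF norm_ge_zero R[of 0]])
  define H where "H m = convex hull (b ` {m..})" for m
  define r where "r m = Inf (norm ` H m)" for m
  \<comment> \<open>Solves \<open>\<epsilon> \<le> (R + 1) * norm (x j - x i) * K\<close> for the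
    separation of the blocks; \<open>R + 1\<close> keeps the denominator positive even if
    \<open>R = 0\<close>.\<close>
  define \<kappa> where "\<kappa> = \<epsilon> / ((R + 1) * K)"
  have \<kappa>: "\<kappa> > 0"
    using \<epsilon> R0 K by (simp add: \<kappa>_def)
  have H_R: "norm x \<le> R" if "x \<in> H m" for x m
  proof -
    have "H m \<subseteq> cball 0 R"
      unfolding H_def using R by (intro hull_minimal) auto
    with that show ?thesis by auto
  qed
  have b_H: "b m \<in> H m" for m
    unfolding H_def by (rule hull_inc) auto
  have bdd: "bdd_below (norm ` H m)" for m
    by (rule bdd_belowI[of _ 0]) auto
  have r_le: "r m \<le> norm x" if "x \<in> H m" for m x
    unfolding r_def using that bdd by (intro cInf_lower) auto
  have r_R: "r m \<le> R" for m
    using r_le[OF b_H[of m]] R[of m] by linarith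
  have bdd_r: "bdd_above (range r)"
    using r_R by (intro bdd_aboveI[of _ R]) auto
  \<comment> \<open>\<open>r m\<close> is the distance from 0 to the hull of the tail starting at
    \<open>m\<close>.\<close>
  define s where "s = (SUP m. r m)"
  have r_s: "r m \<le> s" for m
    unfolding s_def by (rule cSUP_upper[OF _ bdd_r]) simp
  have "0 \<le> r 0"
    unfolding r_def using b_H[of 0] by (intro cInf_greatest) auto
  with r_s[of 0] have s0: "0 \<le> s"
    by linarith
  \<comment> \<open>By continuity of the power at \<open>s\<close>, a thin shell around radius
    \<open>s\<close> has no room for the gain \<open>\<kappa> powr p / c\<close>. The
    \<open>max 0\<close> keeps the base nonnegative.\<close>
  have "((\<lambda>\<eta>. (s + \<eta>) powr p - (max 0 (s - \<eta>)) powr p) \<longlongrightarrow>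
      (s + 0) powr p - (max 0 (s - 0)) powr p) (at_right 0)"
    using s0 beta(2)
    by (intro tendsto_intros tendsto_powr') (auto simp: eventually_at_right_field intro: exI[of _ 1])
  then have "\<forall>\<^sub>F \<eta> in at_right 0. (s + \<eta>) powr p - (max 0 (s - \<eta>)) powr p < \<kappa> powr p / c"
    using s0 \<kappa> c(1) by (intro order_tendstoD(2)) auto
  moreover have "\<forall>\<^sub>F \<eta> in at_right (0::real). \<eta> > 0"
    by (rule eventually_at_right_less)
  ultimately have "\<forall>\<^sub>F \<eta> in at_right 0. (s + \<eta>) powr p - (max 0 (s - \<eta>)) powr p < \<kappa> powr p / c \<and> \<eta> > 0"
    by (rule eventually_conj)
  then obtain \<eta> where \<eta>: "(s + \<eta>) powr p - (max 0 (s - \<eta>)) powr p < \<kappa> powr p / c" "\<eta> > 0"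
    using eventually_happens[of _ "at_right (0::real)"] by auto
  obtain m0 where m0: "s - \<eta> < r m0"
    using less_cSUP_iff[OF _ bdd_r, of "s - \<eta>"] \<eta>(2) unfolding s_def by auto
  have "\<exists>x M. m < M \<and> x \<in> convex hull (b ` {m..<M}) \<and> norm x < s + \<eta>" for m
  proof -
    have "Inf (norm ` H m) < s + \<eta>"
      using r_s[of m] \<eta>(2) unfolding r_def by linarith
    then obtain x where "x \<in> H m" "norm x < s + \<eta>"
      using cInf_lessD[of "norm ` H m"] b_H[of m] by auto
    with convex_hull_image_atLeast[of x b m] show ?thesis
      unfolding H_def by blast
  qed
  then obtain X N where XN: "\<And>m. m < N m" "\<And>m. X m \<in> convex hull (b ` {m..<N m})" "\<And>m. norm (X m) < s + \<eta>"
    by metis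
  \<comment> \<open>Iterating \<open>N\<close> from \<open>m0\<close> makes the blocks consecutive
    and places all of them in the tail starting at \<open>m0\<close>.\<close>
  define M where "M k = (N ^^ k) m0" for k
  have M_Suc: "M (Suc k) = N (M k)" for k
    by (simp add: M_def)
  have M: "strict_mono M"
    unfolding strict_mono_Suc_iff M_Suc using XN(1) by blast
  define x where "x k = X (M k)" for k
  have x_H: "x k \<in> H m" if "m \<le> M k" for k m
  proof -
    have "convex hull (b ` {M k..<N (M k)}) \<subseteq> H m"
      unfolding H_def using that by (intro hull_mono image_mono) auto
    with XN(2) show ?thesis
      unfolding x_def by blast
  qed
  have sep_less: "\<kappa> \<le> norm (x i - x j)" if "i < j" for i j
  proof -
    have "M (Suc i) \<le> M j"
      using that M by (simp add: strict_mono_less_eq)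
    then have xj: "x j \<in> H (M (Suc i))"
      by (rule x_H)
    have xi: "x i \<in> convex hull (b ` {M i..<M (Suc i)})"
      unfolding x_def M_Suc by (rule XN(2))
    have "\<epsilon> \<le> \<omega> (x i) (x j)"
      by (rule form_ge_convex_hull[where b = b, OF ge xi xj[unfolded H_def]])
    also have "\<dots> = \<omega> (x i) (x j - x i)"
      by (simp add: diff_right)
    also have "\<dots> \<le> norm (x i) * norm (x j - x i) * K"
      using K(2)[of "x i" "x j - x i"] by simp
    also have "\<dots> \<le> (R + 1) * norm (x j - x i) * K"
      using H_R[OF x_H[OF order_refl], of i] K(1) by (intro mult_right_mono) auto
    finally show ?thesis
      using K(1) R0 by (simp add: \<kappa>_def divide_le_eq norm_minus_commute mult_ac)
  qed
  have sep: "\<kappa> \<le> norm (x i - x j)" if "i \<noteq> j" for i j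
    using sep_less[of i j] sep_less[of j i] that by (cases "i < j") (auto simp: norm_minus_commute)
  have "\<exists>j. (norm (x 0 + x (Suc j)) / 2) powr p + \<kappa> powr p / c \<le> (s + \<eta>) powr p"
    using XN(3) sep by (intro midpoint_betaD[OF c(2)] \<kappa>) (auto simp: x_def intro: less_imp_le)
  then obtain j where j: "(norm (x 0 + x (Suc j)) / 2) powr p + \<kappa> powr p / c \<le> (s + \<eta>) powr p"
    by blast
  have "m0 \<le> M k" for k
    using strict_mono_less_eq[OF M, of 0 k] by (simp add: M_def)
  then have "(1/2) *\<^sub>R x 0 + (1/2) *\<^sub>R x (Suc j) \<in> H m0"
    unfolding H_def by (intro convexD convex_convex_hull x_H[unfolded H_def]) auto
  from r_le[OF this] have "r m0 \<le> norm (x 0 + x (Suc j)) / 2"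
    by (simp flip: scaleR_add_right)
  then have "max 0 (s - \<eta>) \<le> norm (x 0 + x (Suc j)) / 2"
    using m0 norm_ge_zero[of "x 0 + x (Suc j)"] by (intro max.boundedI) linarith+
  then have "(max 0 (s - \<eta>)) powr p \<le> (norm (x 0 + x (Suc j)) / 2) powr p"
    using beta(2) by (intro powr_mono2) auto
  with j \<eta>(1) show False by linarith
qed

text \<open>Exchanging the arguments turns large negative values into large positive ones, so
  \<open>ex_form_less\<close> excludes both.\<close>

lemma nonnull_alternating_form_flip: "nonnull_alternating_form (\<lambda>x y. \<omega> y x)"
proof (intro nonnull_alternating_form.intro nonnull_alternating_form_axioms.intro)
  show "bounded_bilinear (\<lambda>x y. \<omega> y x)"
    by (rule flip)
  show "\<omega> y x = - \<omega> x y" for x y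
    by (rule antisym)
  show "\<exists>x y. \<omega> y x \<noteq> 0"
    using nonnull by blast
qed

lemma ex_subseq_form_small:
  fixes b :: "nat \<Rightarrow> 'a"
  assumes beta: "property_beta TYPE('a) p" "1 \<le> p"
    and R: "\<And>n. norm (b n) \<le> R" and \<epsilon>: "\<epsilon> > 0"
  shows "\<exists>e :: nat \<Rightarrow> nat. strict_mono e \<and> (\<forall>i j. \<bar>\<omega> (b (e i)) (b (e j))\<bar> < \<epsilon>)"
proof -
  \<comment> \<open>Three colours: large positive, large negative, small. Ramsey's theorem colours
    unordered pairs; \<open>Min\<close> and \<open>Max\<close> restore the order of the
    indices.\<close>
  define f where "f S = (let t = \<omega> (b (Min S)) (b (Max S)) in
      if \<epsilon> \<le> t then 0 else if t \<le> - \<epsilon> then 1 else (2::nat))" for S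
  have "\<exists>Y t. Y \<subseteq> (UNIV :: nat set) \<and> infinite Y \<and> t < 3 \<and> (\<forall>x\<in>Y. \<forall>y\<in>Y. x \<noteq> y \<longrightarrow> f {x, y} = t)"
    by (rule Ramsey2) (auto simp: f_def Let_def)
  then obtain Y t where Y: "infinite Y" "t < 3" "\<forall>x\<in>Y. \<forall>y\<in>Y. x \<noteq> y \<longrightarrow> f {x, y} = t"
    by blast
  define e where "e = enumerate Y"
  have e: "strict_mono e"
    unfolding e_def by (rule strict_mono_enumerate[OF Y(1)])
  have f: "f {e i, e j} = t" if "i < j" for i j
  proof -
    have "e i \<in> Y" "e j \<in> Y"
      unfolding e_def by (rule enumerate_in_set[OF Y(1)])+
    moreover have "e i \<noteq> e j"
      using strict_monoD[OF e that] by simp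
    ultimately show ?thesis
      using Y(3) by blast
  qed
  have MinMax: "Min {e i, e j} = e i" "Max {e i, e j} = e j" if "i < j" for i j
    using strict_monoD[OF e that] by auto
  have "t \<noteq> 0"
  proof
    assume "t = 0"
    have "\<exists>i j. i < j \<and> \<omega> ((b \<circ> e) i) ((b \<circ> e) j) < \<epsilon>"
      by (rule ex_form_less[where R = R, OF beta _ \<epsilon>]) (simp add: R)
    then obtain i j where ij: "i < j" "\<omega> (b (e i)) (b (e j)) < \<epsilon>"
      by auto
    with f[OF ij(1)] \<open>t = 0\<close> show False
      unfolding f_def MinMax[OF ij(1)] by (simp add: Let_def split: if_splits)
  qed
  moreover have "t \<noteq> 1"
  proof
    assume "t = 1"
    have "\<exists>i j. i < j \<and> \<omega> ((b \<circ> e) j) ((b \<circ> e) i) < \<epsilon>"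
      by (rule nonnull_alternating_form.ex_form_less[where R = R, OF nonnull_alternating_form_flip beta _ \<epsilon>])
        (simp add: R)
    then obtain i j where ij: "i < j" "\<omega> (b (e j)) (b (e i)) < \<epsilon>"
      by auto
    with f[OF ij(1)] \<open>t = 1\<close> antisym[of "b (e j)" "b (e i)"] show False
      unfolding f_def MinMax[OF ij(1)] by (simp add: Let_def split: if_splits)
  qed
  ultimately have t: "t = 2"
    using Y(2) by linarith
  have less: "\<bar>\<omega> (b (e i)) (b (e j))\<bar> < \<epsilon>" if "i < j" for i j
    using f[OF that] t unfolding f_def MinMax[OF that] by (simp add: Let_def split: if_splits)
  have "\<bar>\<omega> (b (e i)) (b (e j))\<bar> < \<epsilon>" for i j
    using less[of i j] less[of j i] antisym[of "b (e i)" "b (e j)"] \<epsilon>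
    by (cases i j rule: linorder_cases) auto
  with e show ?thesis
    by (intro exI[of _ e]) simp
qed
lemma ex_subseq_norm_separated:
  fixes x :: "nat \<Rightarrow> 'a \<times> real"
  assumes beta: "property_beta TYPE('a) p" "1 \<le> p"
    and M: "\<And>n. cc_dist \<omega> z (x n) \<le> M"
    and \<delta>: "\<delta> > 0" "\<And>m n. m \<noteq> n \<Longrightarrow> \<delta> \<le> cc_dist \<omega> (x m) (x n)"
  shows "\<exists>e :: nat \<Rightarrow> nat. \<forall>m n. m \<noteq> n \<longrightarrow> \<delta> / 2 \<le> norm (fst (x (e m)) - fst (x (e n)))"
proof -
  obtain C where C: "0 \<le> C" "\<And>u v. cc_dist \<omega> u v \<le> norm (fst v - fst u) + C * sqrt \<bar>vert u v\<bar>"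
    using ex_cc_dist_le by blast
  obtain K where K: "\<And>u v. \<bar>vert u v\<bar> \<le> K * (cc_dist \<omega> u v)\<^sup>2"
    using ex_vert_le_cc_dist by blast
  have cc0: "0 \<le> cc_dist \<omega> u v" for u v
    by (simp add: cc_dist_def)
  \<comment> \<open>Makes \<open>C * sqrt (2 * \<epsilon>)\<close> at most half the separation;
    \<open>C + 1\<close> excludes a zero denominator.\<close>
  define \<epsilon> where "\<epsilon> = (\<delta> / (2 * (C + 1)))\<^sup>2 / 2"
  have \<epsilon>: "\<epsilon> > 0"
    using \<delta>(1) C(1) by (simp add: \<epsilon>_def)
  have "C * sqrt (2 * \<epsilon>) = \<delta> / 2 * (C / (C + 1))"
    using \<delta>(1) C(1) by (simp add: \<epsilon>_def real_sqrt_abs)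
  also have "\<dots> \<le> \<delta> / 2 * 1"
    using \<delta>(1) C(1) by (intro mult_left_mono) auto
  finally have C\<epsilon>: "C * sqrt (2 * \<epsilon>) \<le> \<delta> / 2"
    by simp
  have "\<bar>vert z (x n)\<bar> \<le> \<bar>K\<bar> * M\<^sup>2" for n
  proof -
    have "\<bar>vert z (x n)\<bar> \<le> \<bar>K\<bar> * (cc_dist \<omega> z (x n))\<^sup>2"
      using K[of z "x n"] by (rule order_trans) (intro mult_right_mono, auto)
    also have "\<dots> \<le> \<bar>K\<bar> * M\<^sup>2"
      using M[of n] cc0 by (intro mult_left_mono power_mono) auto
    finally show ?thesis .
  qed
  then have "bounded (range (\<lambda>n. vert z (x n)))"
    unfolding bounded_iff by auto
  then obtain l r where r: "strict_mono r" "((\<lambda>n. vert z (x n)) \<circ> r) \<longlonglongrightarrow> l"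
    using bounded_imp_convergent_subsequence by blast
  then have "Cauchy ((\<lambda>n. vert z (x n)) \<circ> r)"
    by (intro convergent_Cauchy) (auto simp: convergent_def)
  from metric_CauchyD[OF this \<epsilon>]
  obtain n0 where n0: "\<forall>m\<ge>n0. \<forall>n\<ge>n0. \<bar>vert z (x (r m)) - vert z (x (r n))\<bar> < \<epsilon>"
    unfolding dist_real_def o_def by (elim exE)
  define y where "y n = x (r (n0 + n))" for n
  define b where "b n = fst (y n) - fst z" for n
  have bM: "norm (b n) \<le> M" for n
    unfolding b_def y_def by (rule order_trans[OF norm_diff_le_cc_dist M])
  from ex_subseq_form_small[where b = b, OF beta bM \<epsilon>]
  obtain e where e: "strict_mono (e :: nat \<Rightarrow> nat)" "\<forall>i j. \<bar>\<omega> (b (e i)) (b (e j))\<bar> < \<epsilon>"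
    by (elim exE conjE)
  have "\<delta> / 2 \<le> norm (fst (y (e m)) - fst (y (e n)))" if "m \<noteq> n" for m n
  proof -
    have "e m \<noteq> e n"
      using that strict_mono_eq[OF e(1)] by simp
    then have "\<delta> \<le> cc_dist \<omega> (y (e n)) (y (e m))"
      unfolding y_def by (intro \<delta>(2)) (auto simp: strict_mono_eq[OF r(1)])
    also have "\<dots> \<le> norm (fst (y (e m)) - fst (y (e n))) + C * sqrt \<bar>vert (y (e n)) (y (e m))\<bar>"
      by (rule C(2))
    also have "C * sqrt \<bar>vert (y (e n)) (y (e m))\<bar> \<le> C * sqrt (2 * \<epsilon>)"
    proof -
      \<comment> \<open>The group law after left translation by the inverse of \<open>z\<close>. The
        difference of vertical components is small by the Cauchy property, the form by the Ramsey
        argument.\<close>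
      have "vert (y (e n)) (y (e m)) = vert z (y (e m)) - vert z (y (e n)) - \<omega> (b (e n)) (b (e m))"
        using antisym[of "fst z" "fst (y (e n))"]
        by (simp add: vert_def b_def diff_left diff_right)
      moreover have "\<bar>vert z (y (e m)) - vert z (y (e n))\<bar> < \<epsilon>"
        unfolding y_def by (rule n0[rule_format]) auto
      ultimately have "\<bar>vert (y (e n)) (y (e m))\<bar> \<le> 2 * \<epsilon>"
        using e(2)[rule_format, of n m] by linarith
      then show ?thesis
        using C(1) by (intro mult_left_mono) auto
    qed
    finally show ?thesis
      using C\<epsilon> by linarith
  qed
  then show ?thesis
    unfolding y_def by (intro exI[of _ "\<lambda>n. r (n0 + e n)"]) simp
qed

text \<open>Separation is measured by \<open>cc_dist\<close>, but the displacements stay horizontal.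
  Passing to horizontal separation costs the factor 2 in \<open>\<delta> / 2\<close>, the source of
  \<open>2 powr p\<close> in the final constant.\<close>

lemma cc_dist_midpoint_beta:
  assumes beta: "property_beta TYPE('a) p" "1 \<le> p" and c: "midpoint_beta TYPE('a) p c"
    and M: "\<And>n::nat. cc_dist \<omega> z (x n) \<le> M"
    and \<delta>: "\<delta> > 0" "\<And>m n. m \<noteq> n \<Longrightarrow> \<delta> \<le> cc_dist \<omega> (x m) (x n)"
    and A: "norm (fst z - fst w) \<le> A" "\<And>n. norm (fst (x n) - fst z) \<le> A"
  shows "\<exists>n. (norm (fst (x n) - fst w) / 2) powr p + (\<delta> / 2) powr p / c \<le> A powr p"
proof -
  have "\<exists>e :: nat \<Rightarrow> nat. \<forall>m n. m \<noteq> n \<longrightarrow> \<delta> / 2 \<le> norm (fst (x (e m)) - fst (x (e n)))"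
    by (rule ex_subseq_norm_separated[OF beta M \<delta>(1)]) (rule \<delta>(2))
  then obtain e :: "nat \<Rightarrow> nat" where e: "\<forall>m n. m \<noteq> n \<longrightarrow> \<delta> / 2 \<le> norm (fst (x (e m)) - fst (x (e n)))"
    by (elim exE)
  have "\<exists>n. (norm ((fst z - fst w) + (fst (x (e n)) - fst z)) / 2) powr p + (\<delta> / 2) powr p / c \<le> A powr p"
    by (rule midpoint_betaD[OF c A(1)]) (use A(2) \<delta>(1) e in auto)
  then show ?thesis by auto
qed

end

section \<open>Maps on trees\<close>

lemma tree_dist_edge:
  assumes "u \<in> tuples_le h" "u @ [n] \<in> tuples_le h"
  shows "tree_dist h u (u @ [n]) = 1"
  unfolding tree_dist_def
proof (rule Least_equality)
  show "(tree_edge h ^^ 1) u (u @ [n])"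
    using assms by (auto simp: tree_edge_def)
  fix m assume "(tree_edge h ^^ m) u (u @ [n])"
  then show "1 \<le> m"
    by (cases m) auto
qed

lemma tuples_le_appendD: "u @ v \<in> tuples_le h \<Longrightarrow> u \<in> tuples_le h"
  by (auto simp: tuples_le_def sorted_wrt_append)

lemma edge_le_tree_lip:
  assumes "tree_lip d h f \<noteq> \<infinity>" and u: "u @ [n] \<in> tuples_le h"
  shows "d (f u) (f (u @ [n])) \<le> enn2real (tree_lip d h f)"
proof -
  have "ennreal (d (f u) (f (u @ [n])) / real (tree_dist h u (u @ [n]))) \<le> tree_lip d h f"
    unfolding tree_lip_def
    by (rule SUP_upper2[of "(u, u @ [n])"]) (use u tuples_le_appendD[OF u] in auto)
  then have "ennreal (d (f u) (f (u @ [n]))) \<le> tree_lip d h f"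
    by (simp add: tree_dist_edge[OF tuples_le_appendD[OF u] u])
  also have "\<dots> = ennreal (enn2real (tree_lip d h f))"
    using assms(1) by (simp add: less_top)
  finally show ?thesis
    using enn2real_nonneg[of "tree_lip d h f"] by (auto simp: ennreal_le_iff2 intro: order_trans)
qed

text \<open>Repeats the summand of \<open>infrasup_umbel_convex\<close> literally, so that the final
  goal can be folded with \<open>umbel_inf_def[symmetric]\<close>.\<close>

definition umbel_inf :: "('m \<Rightarrow> 'm \<Rightarrow> real) \<Rightarrow> real \<Rightarrow> nat \<Rightarrow> (nat list \<Rightarrow> 'm) \<Rightarrow> nat \<Rightarrow> ennreal" where
  "umbel_inf d p k f s =
     (INF ns \<in> tuples_le (2 ^ k - 2 ^ s).
      INF (i, j) \<in> {(i, j). i \<ge> 1 \<and> j \<ge> 1 \<and> i \<noteq> j}.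
      INF (ms, ms') \<in> {(ms, ms'). ms \<in> tuples (2 ^ s - 1) \<and> ms' \<in> tuples (2 ^ s - 1) \<and>
                         ns @ i # ms \<in> tuples_le (2 ^ k) \<and>
                         ns @ j # ms' \<in> tuples_le (2 ^ k)}.
        ennreal (d (f (ns @ i # ms)) (f (ns @ j # ms')) powr p / 2 powr (real s * p)))"

lemma umbel_inf_le:
  assumes "ns @ i # ms \<in> tuples_le (2 ^ k)" "ns @ j # ms' \<in> tuples_le (2 ^ k)" "i \<noteq> j"
    and "length ns \<le> 2 ^ k - 2 ^ s" "length ms = 2 ^ s - 1" "length ms' = 2 ^ s - 1"
  shows "umbel_inf d p k f s
    \<le> ennreal (d (f (ns @ i # ms)) (f (ns @ j # ms')) powr p / 2 powr (real s * p))"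
proof -
  have 1: "ns \<in> tuples_le (2 ^ k - 2 ^ s)"
    using assms by (auto simp: tuples_le_def sorted_wrt_append)
  have 2: "(i, j) \<in> {(i, j). i \<ge> 1 \<and> j \<ge> 1 \<and> i \<noteq> j}"
    using assms by (auto simp: tuples_le_def)
  have 3: "(ms, ms') \<in> {(ms, ms'). ms \<in> tuples (2 ^ s - 1) \<and> ms' \<in> tuples (2 ^ s - 1) \<and>
      ns @ i # ms \<in> tuples_le (2 ^ k) \<and> ns @ j # ms' \<in> tuples_le (2 ^ k)}"
    using assms by (auto simp: tuples_le_def tuples_def sorted_wrt_append)
  show ?thesis
    unfolding umbel_inf_def
    by (rule INF_lower2[OF 1], rule INF_lower2[OF 2], simp only: prod.case,
        rule INF_lower2[OF 3], simp only: prod.case order_refl)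
qed

text \<open>Allows the summands to be treated as real numbers. One admissible pair suffices:
  directions 1 and 2 at the root, continued by the same entries.\<close>

lemma umbel_inf_finite:
  assumes "s < k"
  shows "umbel_inf d p k f s < \<infinity>"
proof -
  define l :: nat where "l = 2 ^ s"
  have l: "1 \<le> l" "l \<le> 2 ^ k"
    using assms by (auto simp: l_def intro: power_increasing)
  \<comment> \<open>This list has \<open>l - 1\<close> entries, all above 2.\<close>
  let ?ms = "[3..<l + 2]"
  have "[] @ 1 # ?ms \<in> tuples_le (2 ^ k)" "[] @ 2 # ?ms \<in> tuples_le (2 ^ k)"
    using l by (auto simp: tuples_le_def simp del: upt_Suc)
  then have "umbel_inf d p k f s
      \<le> ennreal (d (f ([] @ 1 # ?ms)) (f ([] @ 2 # ?ms)) powr p / 2 powr (real s * p))"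
    using l(1) by (intro umbel_inf_le) (auto simp del: upt_Suc simp flip: l_def)
  also have "\<dots> < \<infinity>"
    by simp
  finally show ?thesis .
qed

section \<open>Induction on scales\<close>

context nonnull_alternating_form
begin

lemma cc_dist_path_le:
  assumes edge: "\<And>u n. u @ [n] \<in> tuples_le h \<Longrightarrow> cc_dist \<omega> (f u) (f (u @ [n])) \<le> \<Lambda>"
    and "u @ v \<in> tuples_le h"
  shows "cc_dist \<omega> (f u) (f (u @ v)) \<le> real (length v) * \<Lambda>"
  using assms(2)
proof (induction v rule: rev_induct)
  interpret Metric_space UNIV "cc_dist \<omega>"
    by (rule Metric_space_cc_dist)
  {
    case Nil
    then show ?case by simp
  next
    case (snoc n v)
    have "cc_dist \<omega> (f u) (f (u @ v @ [n]))
        \<le> cc_dist \<omega> (f u) (f (u @ v)) + cc_dist \<omega> (f (u @ v)) (f (u @ v @ [n]))"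
      by (rule triangle) auto
    also have "\<dots> \<le> real (length v) * \<Lambda> + \<Lambda>"
      using snoc tuples_le_appendD[of "u @ v" "[n]"] edge[of "u @ v" n] by (intro add_mono) auto
    finally show ?case
      by (simp add: algebra_simps)
  }
qed

text \<open>Every direction \<open>i\<close> must be available, because the next scale needs
  descendants in infinitely many directions; only the remaining \<open>2 ^ s - 1\<close> entries may
  be chosen.\<close>

definition reach :: "(nat list \<Rightarrow> 'a \<times> real) \<Rightarrow> real \<Rightarrow> nat \<Rightarrow> nat \<Rightarrow> real \<Rightarrow> bool" where
  "reach f p h s B \<longleftrightarrow>
     (\<forall>ns i. length ns \<le> h - 2 ^ s \<longrightarrow> ns @ [i] \<in> tuples_le h \<longrightarrow>
        (\<exists>ms. length ms = 2 ^ s - 1 \<and> ns @ i # ms \<in> tuples_le h \<and>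
           (norm (fst (f (ns @ i # ms)) - fst (f ns)) / 2 ^ s) powr p \<le> B))"

lemma reach_0:
  assumes "\<And>u n. u @ [n] \<in> tuples_le h \<Longrightarrow> cc_dist \<omega> (f u) (f (u @ [n])) \<le> \<Lambda>" and "0 \<le> p"
  shows "reach f p h 0 (\<Lambda> powr p)"
  unfolding reach_def
proof (intro allI impI exI[of _ "[]"] conjI)
  fix ns i assume "ns @ [i] \<in> tuples_le h"
  then have "norm (fst (f (ns @ [i])) - fst (f ns)) \<le> \<Lambda>"
    using assms(1) norm_diff_le_cc_dist order_trans by blast
  then show "(norm (fst (f (ns @ i # [])) - fst (f ns)) / 2 ^ 0) powr p \<le> \<Lambda> powr p"
    using assms(2) by (intro powr_mono2) auto
qed auto

lemma reach_nonneg: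
  assumes "reach f p (2 ^ k) s B" "s \<le> k"
  shows "0 \<le> B"
proof -
  have "[] @ [1] \<in> tuples_le (2 ^ k)"
    by (simp add: tuples_le_def)
  with assms(1) obtain ms where
    "(norm (fst (f ([] @ 1 # ms)) - fst (f [])) / 2 ^ s) powr p \<le> B"
    unfolding reach_def by (metis le0 list.size(3))
  then show ?thesis
    by (rule order_trans[rotated]) simp
qed
text \<open>From \<open>ns\<close> one descends to \<open>N\<close>, then from \<open>N\<close> into
  infinitely many directions. The endpoints are separated by the umbel term, so some midpoint gains
  by \<open>cc_dist_midpoint_beta\<close>. The alternative \<open>\<delta> = 0\<close> serves scale
  0, where the triangle inequality suffices.\<close>

lemma reach_Suc:
  assumes beta: "property_beta TYPE('a) p" "1 \<le> p" and c: "c > 0" "midpoint_beta TYPE('a) p c"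
    and edge: "\<And>u n. u @ [n] \<in> tuples_le (2 ^ k) \<Longrightarrow> cc_dist \<omega> (f u) (f (u @ [n])) \<le> \<Lambda>"
    and s: "s < k" and B: "reach f p (2 ^ k) s B"
    and \<delta>: "0 \<le> \<delta>" "\<delta> = 0 \<or> ennreal \<delta> \<le> umbel_inf (cc_dist \<omega>) p k f s"
  shows "reach f p (2 ^ k) (Suc s) (B - \<delta> / (2 powr p * c))"
  unfolding reach_def
proof (intro allI impI)
  fix ns i assume len: "length ns \<le> 2 ^ k - 2 ^ Suc s" and ns: "ns @ [i] \<in> tuples_le (2 ^ k)"
  have pow: "(2::nat) ^ Suc s \<le> 2 ^ k"
    using s by (intro power_increasing) auto
  have B0: "0 \<le> B"
    using reach_nonneg[OF B] s by simp
  \<comment> \<open>\<open>B\<close> bounds normalised p-th powers; \<open>A\<close> is the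
    corresponding bound for displacements over \<open>2 ^ s\<close> edges.\<close>
  define A where "A = 2 ^ s * B powr (1 / p)"
  have AB: "A powr p = (2 ^ s) powr p * B"
    using B0 beta(2) by (simp add: A_def powr_mult powr_powr)
  have le_A: "q \<le> A" if "(q / 2 ^ s) powr p \<le> B" "0 \<le> q" for q :: real
  proof -
    have "q / 2 ^ s = ((q / 2 ^ s) powr p) powr (1 / p)"
      using that(2) beta(2) by (simp add: powr_powr)
    also have "\<dots> \<le> B powr (1 / p)"
      using that(1) beta(2) by (intro powr_mono2) auto
    finally show ?thesis
      by (simp add: A_def divide_le_eq mult.commute)
  qed
  have "length ns \<le> 2 ^ k - 2 ^ s"
    using len pow by simp
  with B ns obtain ms where ms: "length ms = 2 ^ s - 1" "ns @ i # ms \<in> tuples_le (2 ^ k)"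
    "(norm (fst (f (ns @ i # ms)) - fst (f ns)) / 2 ^ s) powr p \<le> B"
    unfolding reach_def by blast
  define N where "N = ns @ i # ms"
  have lenN: "length N \<le> 2 ^ k - 2 ^ s"
    using len pow ms(1) by (simp add: N_def)
  \<comment> \<open>Larger than every entry of \<open>N\<close>, so each \<open>J + n\<close>
    extends \<open>N\<close> to an increasing tuple.\<close>
  define J where "J = Suc (sum_list N)"
  have NJ: "N @ [J + n] \<in> tuples_le (2 ^ k)" for n
  proof -
    have "m < J + n" if "m \<in> set N" for m
      using member_le_sum_list[OF that] by (simp add: J_def)
    moreover have "length N < 2 ^ k"
      using lenN pow[unfolded power_Suc] one_le_power[of "2::nat" s] by linarith
    ultimately show ?thesis
      using ms(2) unfolding N_def[symmetric] by (auto simp: tuples_le_def sorted_wrt_append J_def)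
  qed
  have "\<forall>n. \<exists>ms'. length ms' = 2 ^ s - 1 \<and> N @ (J + n) # ms' \<in> tuples_le (2 ^ k) \<and>
      (norm (fst (f (N @ (J + n) # ms')) - fst (f N)) / 2 ^ s) powr p \<le> B"
    using B[unfolded reach_def, rule_format, OF lenN NJ] by (rule allI)
  from choice[OF this] obtain g where
    "\<forall>n. length (g n) = 2 ^ s - 1 \<and> N @ (J + n) # g n \<in> tuples_le (2 ^ k) \<and>
      (norm (fst (f (N @ (J + n) # g n)) - fst (f N)) / 2 ^ s) powr p \<le> B"
    by (elim exE)
  then have g: "length (g n) = 2 ^ s - 1" "N @ (J + n) # g n \<in> tuples_le (2 ^ k)"
    "(norm (fst (f (N @ (J + n) # g n)) - fst (f N)) / 2 ^ s) powr p \<le> B" for n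
    by simp_all
  define x where "x n = f (N @ (J + n) # g n)" for n
  have horiz: "norm (fst (f N) - fst (f ns)) \<le> A" "norm (fst (x n) - fst (f N)) \<le> A" for n
    using le_A ms(3) g(3) by (simp_all add: N_def x_def)
  have "\<exists>n. (norm (fst (x n) - fst (f ns)) / 2) powr p + (2 ^ s) powr p * (\<delta> / (2 powr p * c)) \<le> A powr p"
  proof (cases "\<delta> = 0")
    case True
    have "norm (fst (x 0) - fst (f ns)) \<le> A + A"
      using norm_triangle_ineq[of "fst (x 0) - fst (f N)" "fst (f N) - fst (f ns)"] horiz(1) horiz(2)[of 0]
      by simp
    then have "(norm (fst (x 0) - fst (f ns)) / 2) powr p \<le> A powr p"
      using beta(2) by (intro powr_mono2) auto
    with True show ?thesis
      by auto
  next
    case False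
    \<comment> \<open>Undoes the normalisation of the umbel term: \<open>D\<close> is the separation
      that it forces on endpoints in distinct directions.\<close>
    define D where "D = 2 ^ s * \<delta> powr (1 / p)"
    have D: "D > 0"
      using False \<delta>(1) by (simp add: D_def)
    have sep: "D \<le> cc_dist \<omega> (x m) (x n)" if "m \<noteq> n" for m n
    proof -
      have "ennreal \<delta> \<le> umbel_inf (cc_dist \<omega>) p k f s"
        using \<delta>(2) False by simp
      also have "\<dots> \<le> ennreal (cc_dist \<omega> (x m) (x n) powr p / 2 powr (real s * p))"
        unfolding x_def using that by (intro umbel_inf_le g lenN) simp
      finally have "\<delta> \<le> cc_dist \<omega> (x m) (x n) powr p / 2 powr (real s * p)"
        by (subst (asm) ennreal_le_iff) auto
      then have "\<delta> powr (1 / p) \<le> (cc_dist \<omega> (x m) (x n) powr p / 2 powr (real s * p)) powr (1 / p)"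
        using \<delta>(1) beta(2) by (intro powr_mono2) auto
      also have "\<dots> = cc_dist \<omega> (x m) (x n) / 2 ^ s"
        using beta(2) by (simp add: powr_divide powr_powr powr_realpow cc_dist_def)
      finally show ?thesis
        by (simp add: D_def le_divide_eq mult.commute)
    qed
    \<comment> \<open>Supplies the boundedness from which the small vertical components are
      extracted.\<close>
    have "cc_dist \<omega> (f N) (x n) \<le> real (2 ^ s) * \<Lambda>" for n
    proof -
      have "cc_dist \<omega> (f N) (f (N @ (J + n) # g n)) \<le> real (length ((J + n) # g n)) * \<Lambda>"
        by (rule cc_dist_path_le[OF edge g(2)])
      also have "length ((J + n) # g n) = 2 ^ s"
        by (simp add: g(1))
      finally show ?thesis
        unfolding x_def .
    qed
    then have "\<exists>n. (norm (fst (x n) - fst (f ns)) / 2) powr p + (D / 2) powr p / c \<le> A powr p"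
      by (rule cc_dist_midpoint_beta[OF beta c(2) _ D sep horiz])
    then obtain n where n: "(norm (fst (x n) - fst (f ns)) / 2) powr p + (D / 2) powr p / c \<le> A powr p"
      by (elim exE)
    have "(D / 2) powr p / c = (2 ^ s) powr p * (\<delta> / (2 powr p * c))"
      using \<delta>(1) beta(2) by (simp add: D_def powr_mult powr_divide powr_powr)
    with n show ?thesis by auto
  qed
  then obtain n where n: "(norm (fst (x n) - fst (f ns)) / 2) powr p + (2 ^ s) powr p * (\<delta> / (2 powr p * c)) \<le> A powr p"
    by blast
  show "\<exists>ms. length ms = 2 ^ Suc s - 1 \<and> ns @ i # ms \<in> tuples_le (2 ^ k) \<and>
      (norm (fst (f (ns @ i # ms)) - fst (f ns)) / 2 ^ Suc s) powr p \<le> B - \<delta> / (2 powr p * c)"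
  proof (intro exI[of _ "ms @ (J + n) # g n"] conjI)
    show "length (ms @ (J + n) # g n) = 2 ^ Suc s - 1"
      using ms(1) g(1)[of n] by (simp add: algebra_simps)
    show "ns @ i # ms @ (J + n) # g n \<in> tuples_le (2 ^ k)"
      using g(2)[of n] by (simp add: N_def)
    have "(norm (fst (x n) - fst (f ns)) / 2) powr p
        = (2 ^ s) powr p * (norm (fst (x n) - fst (f ns)) / 2 ^ Suc s) powr p"
      by (simp flip: powr_mult)
    with n AB have "(2 ^ s) powr p * ((norm (fst (x n) - fst (f ns)) / 2 ^ Suc s) powr p + \<delta> / (2 powr p * c))
        \<le> (2 ^ s) powr p * B"
      by (simp add: distrib_left)
    then have "(norm (fst (x n) - fst (f ns)) / 2 ^ Suc s) powr p + \<delta> / (2 powr p * c) \<le> B"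
      by (simp add: mult_le_cancel_left_pos)
    then show "(norm (fst (f (ns @ i # ms @ (J + n) # g n)) - fst (f ns)) / 2 ^ Suc s) powr p
        \<le> B - \<delta> / (2 powr p * c)"
      by (simp add: x_def N_def)
  qed
qed
lemma sum_umbel_inf_le:
  assumes beta: "property_beta TYPE('a) p" "1 \<le> p" and c: "c > 0" "midpoint_beta TYPE('a) p c"
    and edge: "\<And>u n. u @ [n] \<in> tuples_le (2 ^ k) \<Longrightarrow> cc_dist \<omega> (f u) (f (u @ [n])) \<le> \<Lambda>"
    and k: "k \<ge> 1"
  shows "(\<Sum>s = 1..k - 1. umbel_inf (cc_dist \<omega>) p k f s) \<le> ennreal (2 powr p * c * \<Lambda> powr p)"
proof -
  \<comment> \<open>The sum starts at 1, so the step from scale 0 to scale 1 is given no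
    gain.\<close>
  define \<delta> where "\<delta> s = (if s = 0 then 0 else enn2real (umbel_inf (cc_dist \<omega>) p k f s))" for s
  have \<delta>: "ennreal (\<delta> s) = umbel_inf (cc_dist \<omega>) p k f s" if "s \<in> {1..k - 1}" for s
    using that k umbel_inf_finite[of s k "cc_dist \<omega>" p f] by (auto simp: \<delta>_def less_top)
  have \<delta>0: "0 \<le> \<delta> s" for s
    by (simp add: \<delta>_def)
  have "reach f p (2 ^ k) s (\<Lambda> powr p - (\<Sum>r<s. \<delta> r) / (2 powr p * c))" if "s \<le> k" for s
    using that
  proof (induction s)
    case 0
    show ?case
      using reach_0[where p = p, OF edge] beta(2) by simp
  next
    case (Suc s)
    have "\<delta> s = 0 \<or> ennreal (\<delta> s) \<le> umbel_inf (cc_dist \<omega>) p k f s"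
      using \<delta>[of s] Suc.prems by (cases "s = 0") (auto simp: \<delta>_def[of 0])
    moreover have "reach f p (2 ^ k) s (\<Lambda> powr p - (\<Sum>r<s. \<delta> r) / (2 powr p * c))" "s < k"
      using Suc by auto
    ultimately have "reach f p (2 ^ k) (Suc s)
        (\<Lambda> powr p - (\<Sum>r<s. \<delta> r) / (2 powr p * c) - \<delta> s / (2 powr p * c))"
      using reach_Suc[OF beta c edge _ _ \<delta>0] by blast
    then show ?case
      by (simp add: add_divide_distrib diff_diff_eq)
  qed
  \<comment> \<open>At scale \<open>k\<close> all gains have been subtracted from
    \<open>\<Lambda> powr p\<close>, and the result is still nonnegative.\<close>
  from reach_nonneg[OF this[of k]] have "(\<Sum>r<k. \<delta> r) \<le> 2 powr p * c * \<Lambda> powr p"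
    using c(1) by (simp add: divide_le_eq mult.commute)
  moreover have "(\<Sum>s = 1..k - 1. \<delta> s) = (\<Sum>r<k. \<delta> r)"
    by (rule sum.mono_neutral_left) (use k in \<open>auto simp: \<delta>_def\<close>)
  ultimately have "ennreal (\<Sum>s = 1..k - 1. \<delta> s) \<le> ennreal (2 powr p * c * \<Lambda> powr p)"
    by (simp add: ennreal_leI)
  then show ?thesis
    using \<delta> \<delta>0 by (simp flip: sum_ennreal)
qed

end

theorem theoremC:
  fixes p :: real and \<omega> :: "'a::banach \<Rightarrow> 'a \<Rightarrow> real"
  assumes "p \<ge> 2"
    and "property_beta TYPE('a) p"
    and "bounded_bilinear \<omega>"
    and "\<And>x y. \<omega> x y = - \<omega> y x"
    and "\<exists>x y. \<omega> x y \<noteq> 0"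
  shows "infrasup_umbel_convex p (carrier (heisenberg \<omega>)) (cc_dist \<omega>)"
proof -
  interpret nonnull_alternating_form \<omega>
    by (rule nonnull_alternating_form.intro[OF assms(3) nonnull_alternating_form_axioms.intro[OF assms(4,5)]])
  have p: "1 \<le> p"
    using assms(1) by simp
  obtain c where c: "c > 0" "midpoint_beta TYPE('a) p c"
    using property_beta_imp_midpoint_beta[OF assms(2) p] by blast
  define C where "C = (2 powr p * c) powr (1 / p)"
  have C: "C > 0" "C powr p = 2 powr p * c"
    using c(1) p by (simp_all add: C_def powr_powr)
  have "(\<Sum>s = 1..k - 1. umbel_inf (cc_dist \<omega>) p k f s)
      \<le> ennreal (C powr p) * ennreal_powr (tree_lip (cc_dist \<omega>) (2 ^ k) f) p" if k: "k \<ge> 1" for k f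
  proof (cases "tree_lip (cc_dist \<omega>) (2 ^ k) f = \<infinity>")
    \<comment> \<open>The right-hand side is infinite, as \<open>C powr p\<close> is
      positive.\<close>
    case True
    then show ?thesis
      using C(1) by (simp add: ennreal_powr_def ennreal_mult_top)
  next
    case False
    let ?\<Lambda> = "enn2real (tree_lip (cc_dist \<omega>) (2 ^ k) f)"
    have "(\<Sum>s = 1..k - 1. umbel_inf (cc_dist \<omega>) p k f s) \<le> ennreal (2 powr p * c * ?\<Lambda> powr p)"
      by (rule sum_umbel_inf_le[OF assms(2) p c edge_le_tree_lip[OF False] k])
    also have "\<dots> = ennreal (C powr p) * ennreal_powr (tree_lip (cc_dist \<omega>) (2 ^ k) f) p"
      using False c(1) by (simp add: ennreal_powr_def C(2) ennreal_mult)
    finally show ?thesis .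
  qed
  then have "\<forall>k\<ge>1. \<forall>f \<in> tuples_le (2 ^ k) \<rightarrow> carrier (heisenberg \<omega>).
      (\<Sum>s = 1..k - 1. umbel_inf (cc_dist \<omega>) p k f s)
        \<le> ennreal (C powr p) * ennreal_powr (tree_lip (cc_dist \<omega>) (2 ^ k) f) p"
    by blast
  moreover have "carrier (heisenberg \<omega>) = UNIV"
    by (simp add: heisenberg_def)
  then have "Metric_space (carrier (heisenberg \<omega>)) (cc_dist \<omega>)"
    using Metric_space_cc_dist by simp
  ultimately show ?thesis
    unfolding infrasup_umbel_convex_def umbel_inf_def[symmetric]
    using C(1) by (intro conjI exI[of _ C])
qed

end
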